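(* Almost every matroid has a minor isomorphic to $\mathcal{W}^3$ or to $M(K_4)$. That is, if $m(n)$ denotes the number of matroids on the ground set $[n]=\{1,\dots,n\}$ and $m_{\mathcal{X}}(n)$ denotes the number of those having no minor isomorphic to $\mathcal{W}^3$ or $M(K_4)$, then $m_{\mathcal{X}}(n)/m(n)\to 0$ as $n\to\infty$.
   Context: $\mathcal{W}^3$ is the rank-3 whirl: the rank-3 matroid on a 6-element set $\{a,b,c,d,e,f\}$ whose only 3-element circuits (dependent 3-sets) are $\{a,b,c\},\{c,d,e\},\{e,f,a\}$; all other 3-subsets are bases. $M(K_4)$ is the cycle matroid of the complete graph $K_4$; equivalently the rank-3 matroid on $\{a,b,c,d,e,f\}$ whose only dependent 3-sets are $\{a,b,c\},\{c,d,e\},\{e,f,a\},\{b,d,f\}$. Matroids are counted as labelled matroids on the ground set $[n]$. *)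

theory Defs
  imports Complex_Main
begin

definition matroid :: "'a set \<Rightarrow> 'a set set \<Rightarrow> bool" where
  "matroid E Ind \<longleftrightarrow> finite E \<and> (\<forall>X\<in>Ind. X \<subseteq> E) \<and> {} \<in> Ind
     \<and> (\<forall>X Y. X \<in> Ind \<and> Y \<subseteq> X \<longrightarrow> Y \<in> Ind)
     \<and> (\<forall>X Y. X \<in> Ind \<and> Y \<in> Ind \<and> card X < card Y \<longrightarrow> (\<exists>y\<in>Y - X. insert y X \<in> Ind))"

text \<open>Independent sets of the minor M / C \ D (ground set E - C - D), where C, D are
  disjoint subsets of E: X is independent iff X avoids C and D and X \<union> J is independent
  for some basis J of M restricted to C.\<close>
definition minor_indep :: "'a set \<Rightarrow> 'a set set \<Rightarrow> 'a set \<Rightarrow> 'a set \<Rightarrow> 'a set set" where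
  "minor_indep E Ind C D = {X. X \<subseteq> E - C - D \<and>
     (\<exists>J. J \<subseteq> C \<and> J \<in> Ind \<and> (\<forall>y\<in>C - J. insert y J \<notin> Ind) \<and> X \<union> J \<in> Ind)}"

definition matroid_iso :: "'a set \<Rightarrow> 'a set set \<Rightarrow> 'b set \<Rightarrow> 'b set set \<Rightarrow> bool" where
  "matroid_iso E Ind E' Ind' \<longleftrightarrow>
     (\<exists>f. bij_betw f E E' \<and> (\<forall>X. X \<subseteq> E \<longrightarrow> (X \<in> Ind \<longleftrightarrow> f ` X \<in> Ind')))"

definition has_minor_iso :: "'a set \<Rightarrow> 'a set set \<Rightarrow> 'b set \<Rightarrow> 'b set set \<Rightarrow> bool" where
  "has_minor_iso E Ind E' Ind' \<longleftrightarrow>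
     (\<exists>C D. C \<subseteq> E \<and> D \<subseteq> E \<and> C \<inter> D = {} \<and>
        matroid_iso (E - C - D) (minor_indep E Ind C D) E' Ind')"

definition whirl3 :: "nat set set" where
  "whirl3 = {X. X \<subseteq> {1..6} \<and> card X \<le> 3 \<and> X \<notin> {{1,2,3},{3,4,5},{5,6,1}}}"

definition MK4 :: "nat set set" where
  "MK4 = {X. X \<subseteq> {1..6} \<and> card X \<le> 3 \<and> X \<notin> {{1,2,3},{3,4,5},{5,6,1},{2,4,6}}}"

definition num_matroids :: "nat \<Rightarrow> nat" where
  "num_matroids n = card {Ind. matroid {1..n} Ind}"

definition num_matroids_X :: "nat \<Rightarrow> nat" where
  "num_matroids_X n = card {Ind. matroid {1..n} Ind
      \<and> \<not> has_minor_iso {1..n} Ind {1..6::nat} whirl3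
      \<and> \<not> has_minor_iso {1..n} Ind {1..6::nat} MK4}"

end

theory Submission
  imports Defs "HOL-Library.Indicator_Function" "HOL-Analysis.Convex" "HOL-Real_Asymp.Real_Asymp"
begin

text \<open>
  Contracting an independent set of size \<open>r - 3\<close> in a rank-\<open>r\<close> matroid of the class leaves a rank-3
  matroid in which no three lines with at least three points each form a triangle, since such a
  triangle is a whirl or an \<open>M(K\<^sub>4)\<close>. By the Ruzsa-Szemeredi theorem such a matroid on \<open>s\<close> points
  has \<open>o(s\<^sup>2)\<close> point-line incidences on these lines, hence can be encoded by sparse binary relations,
  and there are only \<open>2\<close> to the power \<open>o(s\<^sup>2)\<close> of them. Shearer's inequality, applied to the traces
  of the sets of bases, lifts this to \<open>2\<close> to the power \<open>o(binomial(n, r) / n)\<close> in rank \<open>r\<close>, whereas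
  sparse paving matroids built from a constant-weight code already give at least \<open>2\<close> to the power
  \<open>binomial(n, n/2) / n\<close> matroids.
\<close>

section \<open>Dense systems of triples\<close>

text \<open>With \<open>s = n - r + 3\<close>, the Shearer exponent
  \<open>binomial(n, r - 3) / binomial(r, r - 3)\<close> equals
  \<open>binomial(n, r) / binomial(s, 3)\<close>. A bound of 2 to the power \<open>eps * s^2\<close>
  in rank 3 therefore becomes roughly 2 to the power \<open>6 * eps * binomial(n, r) / s\<close>,
  which stays below half the exponent of the lower bound once \<open>eps\<close> is small against
  \<open>s / n\<close>. So \<open>s\<close> has to be a fixed fraction of \<open>n\<close>; ranks
  near 0 and near \<open>n\<close> are settled by counting all families of \<open>r\<close>-sets,
  since there are few \<open>r\<close>-sets. Unrestricted rank-3 matroids number 2 to a power of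
  order \<open>s^2 * log s\<close> (think of Steiner triple systems), so the absence of triangles
  has to save more than the logarithm. The removal step does without a general regularity lemma: the
  neighbourhoods of a single point already witness irregularity, because they span only an induced
  matching, so it suffices to partition by the neighbourhoods of finitely many points.\<close>

definition cell_avg :: "'a set \<Rightarrow> ('a \<Rightarrow> 'k) \<Rightarrow> ('a \<Rightarrow> real) \<Rightarrow> 'a \<Rightarrow> real" where
  "cell_avg \<Omega> k g x = (\<Sum>y | y \<in> \<Omega> \<and> k y = k x. g y) / card {y \<in> \<Omega>. k y = k x}"

lemma cell_avg_cong: "k x = k y \<Longrightarrow> cell_avg \<Omega> k g x = cell_avg \<Omega> k g y"
  by (simp add: cell_avg_def)

text \<open>\<open>cell_avg\<close> is conditional expectation with respect to the fibres of
  \<open>k\<close>, and this is its defining property: on each fibre \<open>h\<close> is a constant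
  and factors out.\<close>

lemma sum_cell_avg_mult:
  fixes h :: "'a \<Rightarrow> real"
  assumes fin: "finite \<Omega>"
    and h: "\<And>x y. x \<in> \<Omega> \<Longrightarrow> y \<in> \<Omega> \<Longrightarrow> k x = k y \<Longrightarrow> h x = h y"
  shows "(\<Sum>x\<in>\<Omega>. cell_avg \<Omega> k g x * h x) = (\<Sum>x\<in>\<Omega>. g x * h x)"
proof -
  have eq: "(\<Sum>x | x \<in> \<Omega> \<and> k x = i. cell_avg \<Omega> k g x * h x) = (\<Sum>x | x \<in> \<Omega> \<and> k x = i. g x * h x)"
    if i: "i \<in> k ` \<Omega>" for i
  proof -
    let ?F = "{x. x \<in> \<Omega> \<and> k x = i}"
    obtain x0 where x0: "x0 \<in> \<Omega>" "k x0 = i" using i by blast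
    then have "card ?F > 0" using fin by (auto simp: card_gt_0_iff)
    have "(\<Sum>x\<in>?F. cell_avg \<Omega> k g x * h x) = (\<Sum>x\<in>?F. (sum g ?F / card ?F) * h x0)"
    proof (rule sum.cong)
      fix x assume "x \<in> ?F"
      moreover from this have "h x = h x0" by (intro h) (use x0 in auto)
      ultimately show "cell_avg \<Omega> k g x * h x = sum g ?F / card ?F * h x0"
        by (simp add: cell_avg_def)
    qed simp
    also have "\<dots> = sum g ?F * h x0" using \<open>card ?F > 0\<close> by simp
    also have "\<dots> = (\<Sum>x\<in>?F. g x * h x)"
      unfolding sum_distrib_right
    proof (rule sum.cong)
      fix x assume "x \<in> ?F"
      then have "h x = h x0" by (intro h) (use x0 in auto)
      then show "g x * h x0 = g x * h x" by simp
    qed simp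
    finally show ?thesis .
  qed
  have "(\<Sum>x\<in>\<Omega>. cell_avg \<Omega> k g x * h x)
      = (\<Sum>i\<in>k ` \<Omega>. \<Sum>x | x \<in> \<Omega> \<and> k x = i. cell_avg \<Omega> k g x * h x)"
    by (rule sum.image_gen[OF fin])
  also have "\<dots> = (\<Sum>i\<in>k ` \<Omega>. \<Sum>x | x \<in> \<Omega> \<and> k x = i. g x * h x)"
    by (rule sum.cong[OF refl eq])
  also have "\<dots> = (\<Sum>x\<in>\<Omega>. g x * h x)"
    by (rule sum.image_gen[OF fin, symmetric])
  finally show ?thesis .
qed

lemma card_by_cells:
  fixes b :: "'k \<Rightarrow> real"
  assumes "finite V" "S \<subseteq> V"
    and "\<And>i. i \<in> t ` V \<Longrightarrow> card {x \<in> S. t x = i} \<le> b i"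
  shows "card S \<le> (\<Sum>i\<in>t ` V. b i)"
proof -
  have fS: "finite S" using assms finite_subset by blast
  have "real (card S) = (\<Sum>i\<in>t ` V. real (card {x \<in> S. t x = i}))"
  proof -
    have "(\<Sum>i\<in>t ` V. \<Sum>x | x \<in> S \<and> t x = i. (1::real)) = (\<Sum>x\<in>S. 1)"
      by (rule sum.group[OF fS]) (use assms in auto)
    then show ?thesis by simp
  qed
  also have "\<dots> \<le> (\<Sum>i\<in>t ` V. b i)" by (rule sum_mono) (use assms in auto)
  finally show ?thesis .
qed

lemma card_cells_sum:
  assumes "finite V"
  shows "(\<Sum>i\<in>t ` V. real (card {x \<in> V. t x = i})) = card V"
proof -
  have "(\<Sum>i\<in>t ` V. \<Sum>x | x \<in> V \<and> t x = i. (1::real)) = (\<Sum>x\<in>V. 1)"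
    by (rule sum.group) (use assms in auto)
  then show ?thesis by simp
qed

text \<open>A cell in which \<open>A\<close> has density below \<open>e\<close> contributes less
  than an \<open>e\<close> fraction of its size, and the cells add up to \<open>V\<close>.\<close>

lemma card_sparse_trace:
  fixes e :: real
  assumes "finite V" "A \<subseteq> V" "0 \<le> e"
  shows "card {x \<in> A. card {y \<in> A. t y = t x} < e * card {y \<in> V. t y = t x}} \<le> e * card V"
    (is "real (card ?S) \<le> _")
proof -
  have fA: "finite A" using assms finite_subset by blast
  have "card ?S \<le> (\<Sum>i\<in>t ` V. e * card {x \<in> V. t x = i})"
  proof (rule card_by_cells)
    fix i
    show "real (card {x \<in> ?S. t x = i}) \<le> e * card {x \<in> V. t x = i}"
    proof (cases "{x \<in> ?S. t x = i} = {}")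
      case True
      then have c0: "card {x \<in> ?S. t x = i} = 0" by (simp only: card.empty)
      show ?thesis unfolding c0 using assms(3) by simp
    next
      case False
      then obtain x0 where x0: "x0 \<in> ?S" "t x0 = i" by blast
      have "card {x \<in> ?S. t x = i} \<le> card {y \<in> A. t y = i}"
        using fA by (intro card_mono) auto
      moreover have "card {y \<in> A. t y = i} < e * card {y \<in> V. t y = i}" using x0 by auto
      ultimately show ?thesis by linarith
    qed
  qed (use assms in auto)
  then show ?thesis using card_cells_sum[OF assms(1), of t] by (simp flip: sum_distrib_left)
qed

lemma card_small_cells:
  fixes c :: real
  assumes "finite V" "0 \<le> c"
  shows "card {x \<in> V. card {y \<in> V. t y = t x} < c} \<le> c * card (t ` V)" (is "real (card ?S) \<le> _")
proof -
  have "card ?S \<le> (\<Sum>i\<in>t ` V. c)"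
  proof (rule card_by_cells)
    fix i
    show "real (card {x \<in> ?S. t x = i}) \<le> c"
    proof (cases "{x \<in> ?S. t x = i} = {}")
      case True
      then have c0: "card {x \<in> ?S. t x = i} = 0" by (simp only: card.empty)
      show ?thesis unfolding c0 using assms(2) by simp
    next
      case False
      then obtain x0 where x0: "x0 \<in> ?S" "t x0 = i" by blast
      have "card {x \<in> ?S. t x = i} \<le> card {y \<in> V. t y = i}"
        using assms by (intro card_mono) auto
      moreover have "card {y \<in> V. t y = i} < c" using x0 by auto
      ultimately show ?thesis by linarith
    qed
  qed (use assms in auto)
  then show ?thesis by (simp add: mult.commute)
qed

text \<open>The tripartite form of the (6,3) problem, on three copies of \<open>V\<close>: each pair
  of coordinates lies in at most one triple, and \<open>closed\<close> says that three pairs forming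
  a triangle already come from a triple of \<open>T\<close>.\<close>

locale triangle_free_triples =
  fixes V :: "'a set" and T :: "('a \<times> 'a \<times> 'a) set"
  assumes fin: "finite V"
    and sub: "T \<subseteq> V \<times> V \<times> V"
    and det3: "(x, y, z) \<in> T \<Longrightarrow> (x, y, z') \<in> T \<Longrightarrow> z = z'"
    and det2: "(x, y, z) \<in> T \<Longrightarrow> (x, y', z) \<in> T \<Longrightarrow> y = y'"
    and det1: "(x, y, z) \<in> T \<Longrightarrow> (x', y, z) \<in> T \<Longrightarrow> x = x'"
    and closed: "(x, y', z) \<in> T \<Longrightarrow> (x', y, z) \<in> T \<Longrightarrow> (x, y, z') \<in> T \<Longrightarrow> (x, y, z) \<in> T"
begin

abbreviation "n \<equiv> card V"

section \<open>Partitions generated by neighbourhoods, and their energy\<close>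

definition "nbr1 z = {x. \<exists>y. (x, y, z) \<in> T}"
definition "nbr2 z = {y. \<exists>x. (x, y, z) \<in> T}"
definition "shadow = {(x, y). \<exists>z. (x, y, z) \<in> T}"
definition "type1 W x = {z \<in> W. x \<in> nbr1 z}"
definition "type2 W y = {z \<in> W. y \<in> nbr2 z}"
text \<open>Equal keys mean that no vertex of \<open>W\<close> separates the two pairs. The cells
  are rectangles \<open>cell1 W x \<times> cell2 W y\<close>, and the neighbourhoods of a vertex of
  \<open>W\<close> are unions of cells on the respective side.\<close>

definition "key W p = (type1 W (fst p), type2 W (snd p))"
definition "avg W = cell_avg (V \<times> V) (key W) (indicator shadow)"
text \<open>The unnormalised index (mean square density) of regularity arguments.\<close>

definition "energy W = (\<Sum>p\<in>V \<times> V. (avg W p)\<^sup>2)"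
definition "cell1 W x = {x' \<in> V. type1 W x' = type1 W x}"
definition "cell2 W y = {y' \<in> V. type2 W y' = type2 W y}"

lemma nbr1_sub: "nbr1 z \<subseteq> V" and nbr2_sub: "nbr2 z \<subseteq> V"
  using sub by (auto simp: nbr1_def nbr2_def)

lemma finT: "finite T"
  using sub fin finite_subset by blast

lemma sum_avg_mult:
  fixes h :: "'a \<times> 'a \<Rightarrow> real"
  assumes "\<And>p q. key W p = key W q \<Longrightarrow> h p = h q"
  shows "(\<Sum>p\<in>V \<times> V. avg W p * h p) = (\<Sum>p\<in>V \<times> V. indicator shadow p * h p)"
  unfolding avg_def
proof (rule sum_cell_avg_mult)
  show "finite (V \<times> V)" using fin by simp
  show "h p = h q" if "key W p = key W q" for p q using assms that .
qed

lemma avg_cong: "key W p = key W q \<Longrightarrow> avg W p = avg W q"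
  unfolding avg_def by (rule cell_avg_cong)

lemma avg_bounds: "0 \<le> avg W p" "avg W p \<le> 1"
proof -
  have "(\<Sum>q | q \<in> V \<times> V \<and> key W q = key W p. indicator shadow q :: real)
      \<le> (\<Sum>q | q \<in> V \<times> V \<and> key W q = key W p. 1)"
    by (rule sum_mono) (auto simp: indicator_def)
  also have "\<dots> = card {q \<in> V \<times> V. key W q = key W p}" by simp
  finally show "avg W p \<le> 1"
    unfolding avg_def cell_avg_def by (intro divide_le_eq_1[THEN iffD2]) auto
  show "0 \<le> avg W p"
    unfolding avg_def cell_avg_def by (intro divide_nonneg_nonneg sum_nonneg) auto
qed

lemma energy_bounds: "0 \<le> energy W" "energy W \<le> (real n)\<^sup>2"
proof -
  show "0 \<le> energy W" unfolding energy_def by (intro sum_nonneg) auto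
  have "energy W \<le> (\<Sum>p\<in>V \<times> V. 1)"
    unfolding energy_def by (intro sum_mono) (simp add: avg_bounds abs_square_le_1 power_le_one)
  then show "energy W \<le> (real n)\<^sup>2" by (simp add: card_cartesian_product power2_eq_square)
qed

lemma key_mono:
  assumes "W \<subseteq> W'" "key W' p = key W' q"
  shows "key W p = key W q"
proof -
  have "type1 W x = type1 W' x \<inter> W" "type2 W x = type2 W' x \<inter> W" for x
    using assms(1) by (auto simp: type1_def type2_def)
  then show ?thesis using assms(2) by (simp add: key_def)
qed

text \<open>Pythagoras: passing to a finer partition increases the energy by the squared distance of
  the two conditional expectations.\<close>
lemma energy_diff:
  assumes W: "W \<subseteq> W'"
  shows "energy W' - energy W = (\<Sum>p\<in>V \<times> V. (avg W' p - avg W p)\<^sup>2)"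
proof -
  have "(\<Sum>p\<in>V \<times> V. avg W' p * avg W p) = (\<Sum>p\<in>V \<times> V. indicator shadow p * avg W p)"
    by (rule sum_avg_mult) (rule avg_cong[OF key_mono[OF W]])
  also have "\<dots> = (\<Sum>p\<in>V \<times> V. avg W p * avg W p)"
    by (rule sum_avg_mult[symmetric]) (rule avg_cong)
  finally have "(\<Sum>p\<in>V \<times> V. avg W' p * avg W p) = energy W"
    by (simp add: energy_def power2_eq_square)
  then show ?thesis
    by (simp add: energy_def power2_diff sum.distrib sum_subtractf mult.assoc flip: sum_distrib_left)
qed

lemma card_key_image: "finite W \<Longrightarrow> card (key W ` S) \<le> 4 ^ card W"
proof -
  assume W: "finite W"
  have "key W ` S \<subseteq> Pow W \<times> Pow W" by (auto simp: key_def type1_def type2_def)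
  then have "card (key W ` S) \<le> card (Pow W \<times> Pow W)" using W by (intro card_mono) auto
  also have "\<dots> = 4 ^ card W" using W
    by (simp add: card_cartesian_product card_Pow flip: power_mult_distrib)
  finally show ?thesis .
qed

text \<open>By \<open>det1\<close> to \<open>det3\<close> a triple is recovered from any two of its
  coordinates, so triples can be counted by pairs.\<close>

lemma card_triples_le:
  assumes "finite B" "S \<subseteq> T" "f ` S \<subseteq> B"
    and "f = (\<lambda>(x, y, z). (x, y)) \<or> f = (\<lambda>(x, y, z). (z, x)) \<or> f = (\<lambda>(x, y, z). (z, y))"
  shows "card S \<le> card B"
proof (rule card_inj_on_le[OF _ assms(3,1)])
  show "inj_on f S"
  proof (rule inj_onI)
    fix p q assume pq: "p \<in> S" "q \<in> S" "f p = f q"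
    obtain x y z x' y' z' where p: "p = (x, y, z)" "q = (x', y', z')" by (metis prod_cases3)
    have "(x, y, z) \<in> T" "(x', y', z') \<in> T" using pq p assms(2) by auto
    then show "p = q" using assms(4) pq(3) det1 det2 det3 unfolding p by auto
  qed
qed

text \<open>The condition on \<open>avg\<close> is constant on cells, so \<open>shadow\<close> may
  be replaced by its average in the sum, and that average is below \<open>e\<close> wherever it is
  summed.\<close>

lemma card_low_density:
  fixes e :: real
  assumes "0 \<le> e"
  shows "card {(x, y, z) \<in> T. avg W (x, y) < e} \<le> e * (real n)\<^sup>2" (is "real (card ?S) \<le> _")
proof -
  let ?B = "{p \<in> V \<times> V. p \<in> shadow \<and> avg W p < e}"
  have "card ?S \<le> card ?B"
    by (rule card_triples_le[where f = "\<lambda>(x, y, z). (x, y)"])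
      (use fin sub in \<open>auto simp: shadow_def\<close>)
  also have "real (card ?B) = (\<Sum>p\<in>V \<times> V. indicator shadow p * (if avg W p < e then 1 else 0))"
    using fin by (simp add: indicator_def flip: sum.inter_filter)
  also have "\<dots> = (\<Sum>p\<in>V \<times> V. avg W p * (if avg W p < e then 1 else 0))"
    by (rule sum_avg_mult[symmetric]) (erule arg_cong[OF avg_cong, where f = "\<lambda>a. if a < e then 1 else 0"])
  also have "\<dots> \<le> (\<Sum>p\<in>V \<times> V. e)" by (rule sum_mono) (use assms in auto)
  also have "\<dots> = e * (real n)\<^sup>2" by (simp add: card_cartesian_product power2_eq_square)
  finally show ?thesis by simp
qed

lemma card_small_cell:
  fixes c :: real
  assumes "0 \<le> c" "finite W"
  shows "card {(x, y, z) \<in> T. card (cell2 W y) < c} \<le> n * (c * 2 ^ card W)" (is "real (card ?S) \<le> _")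
proof -
  let ?B = "{y \<in> V. card {y' \<in> V. type2 W y' = type2 W y} < c}"
  have "card ?S \<le> card (V \<times> ?B)"
    by (rule card_triples_le[where f = "\<lambda>(x, y, z). (x, y)"])
      (use fin sub in \<open>auto simp: cell2_def\<close>)
  also have "\<dots> = n * card ?B" by (simp add: card_cartesian_product)
  also have "real (n * card ?B) \<le> n * (c * 2 ^ card W)"
  proof -
    have "type2 W ` V \<subseteq> Pow W" by (auto simp: type2_def)
    then have "card (type2 W ` V) \<le> 2 ^ card W" 
      using assms(2) card_mono[of "Pow W" "type2 W ` V"] by (simp add: card_Pow)
    then have "real (card (type2 W ` V)) \<le> 2 ^ card W" by (metis of_nat_le_iff of_nat_numeral of_nat_power)
    then have "c * card (type2 W ` V) \<le> c * 2 ^ card W" using assms by (intro mult_left_mono) auto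
    then have "card ?B \<le> c * 2 ^ card W" using card_small_cells[OF fin assms(1), of "type2 W"] by linarith
    then show ?thesis by (simp add: mult_left_mono)
  qed
  finally show ?thesis by simp
qed

text \<open>For fixed \<open>z\<close>, \<open>card_sparse_trace\<close> applies to
  \<open>nbr1 z\<close>; the triple is counted by its pair \<open>(z, x)\<close>.\<close>

lemma card_sparse1:
  fixes e :: real
  assumes "0 \<le> e"
  shows "card {(x, y, z) \<in> T. card (nbr1 z \<inter> cell1 W x) < e * card (cell1 W x)} \<le> e * (real n)\<^sup>2"
    (is "real (card ?S) \<le> _")
proof -
  let ?B = "\<lambda>z. {x \<in> nbr1 z. card {x' \<in> nbr1 z. type1 W x' = type1 W x} < e * card {x' \<in> V. type1 W x' = type1 W x}}"
  have finB: "finite (?B z)" for z using nbr1_sub[of z] fin finite_subset by fastforce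
  have eq: "nbr1 z \<inter> cell1 W x = {x' \<in> nbr1 z. type1 W x' = type1 W x}" for x z
    using nbr1_sub[of z] by (auto simp: cell1_def)
  have "card ?S \<le> card (Sigma V ?B)"
  proof (rule card_triples_le[where f = "\<lambda>(x, y, z). (z, x)"])
    show "(\<lambda>(x, y, z). (z, x)) ` ?S \<subseteq> Sigma V ?B"
      using sub unfolding eq by (auto simp: nbr1_def cell1_def)
  qed (use fin finB in auto)
  also have "\<dots> = (\<Sum>z\<in>V. card (?B z))" using fin finB by simp
  also have "real \<dots> = (\<Sum>z\<in>V. real (card (?B z)))" by simp
  also have "\<dots> \<le> (\<Sum>z\<in>V. e * real n)"
    by (rule sum_mono) (rule card_sparse_trace[OF fin nbr1_sub assms])
  also have "\<dots> = e * (real n)\<^sup>2" by (simp add: power2_eq_square)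
  finally show ?thesis by simp
qed

lemma card_sparse2:
  fixes e :: real
  assumes "0 \<le> e"
  shows "card {(x, y, z) \<in> T. card (nbr2 z \<inter> cell2 W y) < e * card (cell2 W y)} \<le> e * (real n)\<^sup>2"
    (is "real (card ?S) \<le> _")
proof -
  let ?B = "\<lambda>z. {x \<in> nbr2 z. card {x' \<in> nbr2 z. type2 W x' = type2 W x} < e * card {x' \<in> V. type2 W x' = type2 W x}}"
  have finB: "finite (?B z)" for z using nbr2_sub[of z] fin finite_subset by fastforce
  have eq: "nbr2 z \<inter> cell2 W x = {x' \<in> nbr2 z. type2 W x' = type2 W x}" for x z
    using nbr2_sub[of z] by (auto simp: cell2_def)
  have "card ?S \<le> card (Sigma V ?B)"
  proof (rule card_triples_le[where f = "\<lambda>(x, y, z). (z, y)"])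
    show "(\<lambda>(x, y, z). (z, y)) ` ?S \<subseteq> Sigma V ?B"
      using sub unfolding eq by (auto simp: nbr2_def cell2_def)
  qed (use fin finB in auto)
  also have "\<dots> = (\<Sum>z\<in>V. card (?B z))" using fin finB by simp
  also have "real \<dots> = (\<Sum>z\<in>V. real (card (?B z)))" by simp
  also have "\<dots> \<le> (\<Sum>z\<in>V. e * real n)"
    by (rule sum_mono) (rule card_sparse_trace[OF fin nbr2_sub assms])
  also have "\<dots> = e * (real n)\<^sup>2" by (simp add: power2_eq_square)
  finally show ?thesis by simp
qed

text \<open>The pairs of \<^term>\<open>shadow\<close> inside \<^term>\<open>nbr1 z \<times> nbr2 z\<close> form an induced matching.\<close>
lemma card_edges_block:
  assumes "X \<subseteq> nbr1 z" "Y \<subseteq> nbr2 z"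
  shows "card (shadow \<inter> X \<times> Y) \<le> card X"
proof (rule card_inj_on_le[where f = fst])
  have T: "(fst p, snd p, z) \<in> T" if "p \<in> shadow \<inter> X \<times> Y" for p
  proof -
    have "fst p \<in> nbr1 z" "snd p \<in> nbr2 z" "(fst p, snd p) \<in> shadow" using that assms by auto
    then show ?thesis unfolding nbr1_def nbr2_def shadow_def using closed by blast
  qed
  show "inj_on fst (shadow \<inter> X \<times> Y)"
  proof (rule inj_onI)
    fix p q assume pq: "p \<in> shadow \<inter> X \<times> Y" "q \<in> shadow \<inter> X \<times> Y" and fst: "fst p = fst q"
    have "(fst q, snd p, z) \<in> T" using T[OF pq(1)] unfolding fst .
    then have "snd p = snd q" using T[OF pq(2)] by (rule det2)
    with fst show "p = q" by (rule prod_eqI)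
  qed
  show "finite X" by (rule finite_subset[OF order_trans[OF assms(1) nbr1_sub] fin])
qed auto

text \<open>Discarded are the triples in sparse cells, in cells that are too small, and those for
  which a neighbourhood of \<open>z\<close> is thin in the cell. In each cell met by a surviving
  triple \<open>(x, y, z)\<close>, the rectangle \<open>nbr1 z \<times> nbr2 z\<close> fills at
  least an \<open>e\<^sup>2\<close> fraction of the cell but carries only an induced matching,
  although the cell has density at least \<open>e\<close>. Adding one such \<open>z\<close> per cell
  separates these rectangles and gains energy \<open>e ^ 4 / 2\<close> times the size of the
  cell.\<close>

lemma energy_increment:
  fixes e :: real
  assumes e: "0 < e" and W: "finite W"
  shows "\<exists>W'. W \<subseteq> W' \<and> finite W' \<and> card W' \<le> card W + 4 ^ card W \<and>
    energy W' \<ge> energy W + e ^ 4 / 2 * (card T - 3 * e * (real n)\<^sup>2 - n * (4 / e\<^sup>2 * 2 ^ card W))"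
proof -
  define Ba where "Ba = {(x, y, z) \<in> T. avg W (x, y) < e}"
  \<comment> \<open>If \<open>cell2\<close> has at least \<open>4 / e\<^sup>2\<close> points and
    \<open>nbr2 z\<close> holds an \<open>e\<close> fraction of them, then density times
    \<open>card B\<close> is at least 4, which absorbs a matching of size at most
    \<open>card A\<close>.\<close>
  define Bb where "Bb = {(x, y, z) \<in> T. card (cell2 W y) < 4 / e\<^sup>2}"
  define Bc where "Bc = {(x, y, z) \<in> T. card (nbr1 z \<inter> cell1 W x) < e * card (cell1 W x)}"
  define Bd where "Bd = {(x, y, z) \<in> T. card (nbr2 z \<inter> cell2 W y) < e * card (cell2 W y)}"
  define G where "G = T - Ba - Bb - Bc - Bd"
  define f where "f = (\<lambda>(x, y, z :: 'a). (x :: 'a, y :: 'a))"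
  define I where "I = key W ` f ` G"
  define cell where "cell i = {p \<in> V \<times> V. key W p = i}" for i
  have fins: "finite Ba" "finite Bb" "finite Bc" "finite Bd" "finite G" "finite I"
    using finT finite_subset[OF _ finT] unfolding Ba_def Bb_def Bc_def Bd_def G_def I_def
    by (auto intro: finite_subset[OF _ finT])
  have finC: "finite (cell i)" for i using fin by (auto simp: cell_def)
  have "card T \<le> card (Ba \<union> (Bb \<union> (Bc \<union> (Bd \<union> G))))"
    using fins by (intro card_mono) (auto simp: G_def)
  also have "\<dots> \<le> card Ba + (card Bb + (card Bc + (card Bd + card G)))"
    by (meson card_Un_le add_left_mono order_trans)
  finally have "real (card T) \<le> card Ba + card Bb + card Bc + card Bd + card G" by linarith
  moreover have "card Ba \<le> e * (real n)\<^sup>2" unfolding Ba_def using card_low_density e by simp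
  moreover have "card Bb \<le> n * (4 / e\<^sup>2 * 2 ^ card W)"
    unfolding Bb_def by (rule card_small_cell) (use W in auto)
  moreover have "card Bc \<le> e * (real n)\<^sup>2" unfolding Bc_def using card_sparse1 e by simp
  moreover have "card Bd \<le> e * (real n)\<^sup>2" unfolding Bd_def using card_sparse2 e by simp
  ultimately have G1: "card G \<ge> card T - 3 * e * (real n)\<^sup>2 - n * (4 / e\<^sup>2 * 2 ^ card W)"
    by linarith
  \<comment> \<open>The cells indexed by \<open>I\<close> contain the pairs of all surviving
    triples, so a gain proportional to cell sizes is a gain proportional to
    \<open>card G\<close>.\<close>
  have "card G \<le> card (\<Union>i\<in>I. cell i)"
  proof (rule card_triples_le[where f = f])
    show "f ` G \<subseteq> (\<Union>i\<in>I. cell i)" using sub by (fastforce simp: I_def cell_def f_def G_def)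
  qed (use fins finC in \<open>auto simp: G_def f_def\<close>)
  also have "\<dots> \<le> (\<Sum>i\<in>I. card (cell i))" using fins by (intro card_UN_le)
  finally have G2: "real (card G) \<le> (\<Sum>i\<in>I. real (card (cell i)))" by (simp flip: of_nat_sum)

  have "\<forall>i\<in>I. \<exists>x y z. (x, y, z) \<in> G \<and> key W (x, y) = i" by (force simp: I_def f_def)
  then obtain fx fy fz where w: "\<And>i. i \<in> I \<Longrightarrow> (fx i, fy i, fz i) \<in> G \<and> key W (fx i, fy i) = i"
    by metis
  define W' where "W' = W \<union> fz ` I"
  have WW': "W \<subseteq> W'" by (simp add: W'_def)
  define D where "D i = {p \<in> cell i. fst p \<in> nbr1 (fz i) \<and> snd p \<in> nbr2 (fz i)}" for i
  define DD where "DD = (\<Union>i\<in>I. D i)"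
  have DDsub: "DD \<subseteq> V \<times> V" by (auto simp: DD_def D_def cell_def)
  have finD: "finite (D i)" for i using finC by (simp add: D_def)
  have disj: "\<forall>i\<in>I. \<forall>j\<in>I. i \<noteq> j \<longrightarrow> D i \<inter> D j = {}" by (auto simp: D_def cell_def)
  \<comment> \<open>\<open>h\<close> is \<open>avg W\<close> cut off to the chosen rectangles. These
    are cut out by vertices of \<open>W'\<close>, so \<open>h\<close> is constant on the cells of
    \<open>W'\<close> and can be tested against \<open>avg W'\<close>.\<close>
  define h where "h p = (if fst p \<in> nbr1 (fz (key W p)) \<and> snd p \<in> nbr2 (fz (key W p)) \<and> key W p \<in> I
    then avg W p else 0)" for p
  have hD: "(\<Sum>p\<in>V \<times> V. a p * h p) = (\<Sum>p\<in>DD. a p * avg W p)" for a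
  proof -
    have "(\<Sum>p\<in>V \<times> V. a p * h p) = (\<Sum>p\<in>V \<times> V. if p \<in> DD then a p * avg W p else 0)"
      by (rule sum.cong) (auto simp: h_def DD_def D_def cell_def)
    also have "\<dots> = (\<Sum>p\<in>{p \<in> V \<times> V. p \<in> DD}. a p * avg W p)"
      using fin by (subst sum.inter_filter) auto
    also have "{p \<in> V \<times> V. p \<in> DD} = DD" using DDsub by auto
    finally show ?thesis .
  qed
  have hcong: "h p = h q" if k: "key W' p = key W' q" for p q
  proof (cases "key W p \<in> I")
    case True
    have kW: "key W p = key W q" using key_mono[OF WW' k] .
    have "fz (key W p) \<in> W'" using True by (auto simp: W'_def)
    then have "(fst p \<in> nbr1 (fz (key W p))) = (fst q \<in> nbr1 (fz (key W p)))"
      "(snd p \<in> nbr2 (fz (key W p))) = (snd q \<in> nbr2 (fz (key W p)))"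
      using k by (auto simp: key_def type1_def type2_def)
    then show ?thesis using kW avg_cong[OF kW] by (auto simp: h_def)
  next
    case False
    then show ?thesis using key_mono[OF WW' k] by (auto simp: h_def)
  qed
  have "(\<Sum>p\<in>DD. avg W' p * avg W p) = (\<Sum>p\<in>DD. indicator shadow p * avg W p)"
    using sum_avg_mult[of W' h, OF hcong] unfolding hD .
  then have "(\<Sum>p\<in>DD. (avg W p)\<^sup>2 - 2 * (indicator shadow p * avg W p))
      = (\<Sum>p\<in>DD. (avg W p)\<^sup>2 - 2 * (avg W' p * avg W p))"
    by (simp add: sum_subtractf flip: sum_distrib_left)
  \<comment> \<open>Dropping \<open>(avg W' p)\<^sup>2\<close> leaves only terms that the test
    function evaluates, so the densities of the refined partition need not be computed.\<close>
  also have "\<dots> \<le> (\<Sum>p\<in>DD. (avg W' p - avg W p)\<^sup>2)"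
    by (rule sum_mono) (simp add: power2_diff)
  also have "\<dots> \<le> (\<Sum>p\<in>V \<times> V. (avg W' p - avg W p)\<^sup>2)"
    using fin DDsub by (intro sum_mono2) auto
  also have "\<dots> = energy W' - energy W" using energy_diff[OF WW'] by simp
  finally have inc: "energy W' - energy W \<ge> (\<Sum>i\<in>I. \<Sum>p\<in>D i. (avg W p)\<^sup>2 - 2 * (indicator shadow p * avg W p))"
    unfolding DD_def by (subst (asm) sum.UNION_disjoint) (use fins finD disj in auto)

  have blk: "(\<Sum>p\<in>D i. (avg W p)\<^sup>2 - 2 * (indicator shadow p * avg W p)) \<ge> e ^ 4 / 2 * card (cell i)"
    if i: "i \<in> I" for i
  proof -
    define x y z where "x = fx i" "y = fy i" "z = fz i"
    have xyz: "(x, y, z) \<in> G" "key W (x, y) = i" using w[OF i] by (simp_all add: x_y_z_def)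
    define A B where "A = nbr1 z \<inter> cell1 W x" "B = nbr2 z \<inter> cell2 W y"
    define d where "d = avg W (x, y)"
    have cond: "d \<ge> e" "card (cell2 W y) \<ge> 4 / e\<^sup>2" "card A \<ge> e * card (cell1 W x)"
      "card B \<ge> e * card (cell2 W y)"
      using xyz(1) by (auto simp: G_def Ba_def Bb_def Bc_def Bd_def A_B_def d_def not_less)
    have celleq: "cell i = cell1 W x \<times> cell2 W y"
      using xyz(2) by (auto simp: cell_def cell1_def cell2_def key_def)
    have Deq: "D i = A \<times> B"
      unfolding D_def celleq A_B_def x_y_z_def(3) by auto
    have avgD: "avg W p = d" if "p \<in> D i" for p
      unfolding d_def using that xyz(2) by (intro avg_cong) (auto simp: D_def cell_def)
    have "(\<Sum>p\<in>D i. (avg W p)\<^sup>2 - 2 * (indicator shadow p * avg W p)) = (\<Sum>p\<in>D i. d\<^sup>2 - 2 * (indicator shadow p * d))"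
      by (rule sum.cong) (use avgD in auto)
    also have "\<dots> = d\<^sup>2 * card (D i) - 2 * d * (\<Sum>p\<in>D i. indicator shadow p)"
      by (simp add: sum_subtractf mult_ac flip: sum_distrib_left sum_distrib_right)
    also have "(\<Sum>p\<in>D i. indicator shadow p :: real) = card (shadow \<inter> A \<times> B)"
      using finD[of i] unfolding Deq by (simp add: indicator_def sum.If_cases Int_commute)
    finally have eq: "(\<Sum>p\<in>D i. (avg W p)\<^sup>2 - 2 * (indicator shadow p * avg W p))
      = d\<^sup>2 * (real (card A) * card B) - 2 * d * card (shadow \<inter> A \<times> B)"
      by (simp add: Deq card_cartesian_product)
    have "card (shadow \<inter> A \<times> B) \<le> card A" by (rule card_edges_block) (auto simp: A_B_def)
    moreover have "4 \<le> d * card B"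
    proof -
      have "e * (4 / e\<^sup>2) \<le> e * card (cell2 W y)" using cond(2) e by (intro mult_left_mono) auto
      then have "4 / e \<le> card B" using cond(4) e by (simp add: power2_eq_square)
      then have "e * (4 / e) \<le> d * card B" using cond(1) e by (intro mult_mono) auto
      then show ?thesis using e by simp
    qed
    then have "4 * (d * card A) \<le> (d * card B) * (d * card A)"
      using cond(1) e by (intro mult_right_mono) auto
    ultimately have "2 * d * card (shadow \<inter> A \<times> B) \<le> d\<^sup>2 * (real (card A) * card B) / 2"
      using cond(1) e mult_left_mono[of "real (card (shadow \<inter> A \<times> B))" "card A" "2 * d"]
      by (simp add: power2_eq_square mult_ac)
    moreover have "e\<^sup>2 * ((e * card (cell1 W x)) * (e * card (cell2 W y))) \<le> d\<^sup>2 * (real (card A) * card B)"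
      using cond e by (intro mult_mono power_mono) auto
    ultimately show ?thesis unfolding eq celleq
      by (simp add: card_cartesian_product power4_eq_xxxx power2_eq_square mult_ac)
  qed
  have "e ^ 4 / 2 * (card T - 3 * e * (real n)\<^sup>2 - n * (4 / e\<^sup>2 * 2 ^ card W))
      \<le> e ^ 4 / 2 * (\<Sum>i\<in>I. real (card (cell i)))"
    using G1 G2 e by (intro mult_left_mono) auto
  also have "\<dots> \<le> (\<Sum>i\<in>I. \<Sum>p\<in>D i. (avg W p)\<^sup>2 - 2 * (indicator shadow p * avg W p))"
    unfolding sum_distrib_left by (rule sum_mono) (rule blk)
  finally have fin1: "energy W' \<ge> energy W + e ^ 4 / 2 * (card T - 3 * e * (real n)\<^sup>2 - n * (4 / e\<^sup>2 * 2 ^ card W))"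
    using inc by linarith
  have "card W' \<le> card W + card I"
    unfolding W'_def using card_Un_le[of W "fz ` I"] card_image_le[OF fins(6), of fz] by linarith
  also have "card I \<le> 4 ^ card W" unfolding I_def by (rule card_key_image[OF W])
  finally show ?thesis using fin1 WW' W fins by (intro exI[of _ W']) (auto simp: W'_def)
qed

end

text \<open>Bounds \<open>card W\<close> after \<open>j\<close> refinements: each adds at most one
  vertex per cell, and there are at most \<open>4 ^ card W\<close> cells.\<close>

primrec tower :: "nat \<Rightarrow> nat" where
  "tower 0 = 0"
| "tower (Suc j) = tower j + 4 ^ tower j"

text \<open>A dense \<open>T\<close> would allow \<open>energy_increment\<close> to be iterated with
  a gain of \<open>a ^ 5 / 2 * n\<^sup>2\<close> each time, but the energy never exceeds
  \<open>n\<^sup>2\<close>.\<close>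

theorem ruzsa_szemeredi:
  fixes e :: real
  assumes e: "0 < e"
  shows "\<exists>N. \<forall>(V :: 'a set) T. triangle_free_triples V T \<and> card V \<ge> N \<longrightarrow> card T \<le> e * (real (card V))\<^sup>2"
proof -
  \<comment> \<open>Five shares of \<open>a\<close>: three pay for the sparse classes, one for the
    small cells, and one is left as gain.\<close>
  define a where "a = e / 5"
  have a: "a > 0" using e by (simp add: a_def)
  define J where "J = Suc (nat \<lceil>2 / a ^ 5\<rceil>)"
  \<comment> \<open>Large enough for the loss from small cells to stay below
    \<open>a * n\<^sup>2\<close> at every one of the \<open>J\<close> refinements.\<close>
  define N where "N = Suc (nat \<lceil>4 / a ^ 3 * 2 ^ tower J\<rceil>)"
  have "card T \<le> e * (real (card V))\<^sup>2" if tf: "triangle_free_triples V T" and N: "card V \<ge> N" for V :: "'a set" and T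
  proof (rule ccontr)
    assume neg: "\<not> card T \<le> e * (real (card V))\<^sup>2"
    interpret triangle_free_triples V T by (rule tf)
    have mono: "tower i \<le> tower j" if "i \<le> j" for i j
      using that by (rule lift_Suc_mono_le[of tower, rotated]) simp
    have npos: "real n > 0" and nN: "real n \<ge> 4 / a ^ 3 * 2 ^ tower J"
      using N by (simp_all add: N_def) linarith
    have "\<exists>W. finite W \<and> card W \<le> tower j \<and> energy W \<ge> j * (a ^ 5 / 2 * (real n)\<^sup>2)" if "j \<le> J" for j
      using that
    proof (induction j)
      case 0
      then show ?case by (intro exI[of _ "{}"]) (simp add: energy_bounds)
    next
      case (Suc j)
      then obtain W where W: "finite W" "card W \<le> tower j" "energy W \<ge> j * (a ^ 5 / 2 * (real n)\<^sup>2)"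
        by auto
      obtain W' where W': "finite W'" "card W' \<le> card W + 4 ^ card W"
        "energy W' \<ge> energy W + a ^ 4 / 2 * (card T - 3 * a * (real n)\<^sup>2 - n * (4 / a\<^sup>2 * 2 ^ card W))"
        using energy_increment[OF a W(1)] by blast
      have "card W + 4 ^ card W \<le> tower j + 4 ^ tower j"
        using W(2) by (intro add_mono power_increasing) auto
      then have c: "card W' \<le> tower (Suc j)" using W'(2) by simp
      have "(2::real) ^ card W \<le> 2 ^ tower J"
        using W(2) mono[of j J] Suc.prems by (intro power_increasing) auto
      then have "4 / a ^ 3 * 2 ^ card W \<le> 4 / a ^ 3 * 2 ^ tower J"
        using a by (intro mult_left_mono) auto
      then have "4 / a ^ 3 * 2 ^ card W \<le> n" using nN by linarith
      then have "(n * a) * (4 / a ^ 3 * 2 ^ card W) \<le> (n * a) * n"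
        using a by (intro mult_left_mono) auto
      then have "n * (4 / a\<^sup>2 * 2 ^ card W) \<le> a * (real n)\<^sup>2"
        using a by (simp add: power3_eq_cube power2_eq_square field_simps)
      moreover have "card T \<ge> 5 * a * (real n)\<^sup>2" using neg by (simp add: a_def)
      ultimately have "card T - 3 * a * (real n)\<^sup>2 - n * (4 / a\<^sup>2 * 2 ^ card W) \<ge> a * (real n)\<^sup>2"
        by (simp add: algebra_simps)
      then have "a ^ 4 / 2 * (card T - 3 * a * (real n)\<^sup>2 - n * (4 / a\<^sup>2 * 2 ^ card W)) \<ge> a ^ 4 / 2 * (a * (real n)\<^sup>2)"
        using a by (intro mult_left_mono) auto
      then have "energy W' \<ge> Suc j * (a ^ 5 / 2 * (real n)\<^sup>2)"
        using W'(3) W(3) by (simp add: algebra_simps eval_nat_numeral)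
      then show ?case using W'(1) c by blast
    qed
    then obtain W where "energy W \<ge> J * (a ^ 5 / 2 * (real n)\<^sup>2)" by blast
    then have "J * (a ^ 5 / 2 * (real n)\<^sup>2) \<le> (real n)\<^sup>2" using energy_bounds(2)[of W] by linarith
    then have "(J * (a ^ 5 / 2)) * (real n)\<^sup>2 \<le> 1 * (real n)\<^sup>2" by (simp add: mult_ac)
    then have "J * (a ^ 5 / 2) \<le> 1" using npos by (simp only: mult_le_cancel_right) auto
    then have "J \<le> 2 / a ^ 5" using a by (simp add: field_simps)
    moreover have "J > 2 / a ^ 5" unfolding J_def by linarith
    ultimately show False by linarith
  qed
  then show ?thesis by blast
qed

section \<open>Planes without triangles\<close>

text \<open>Triples with a repeated point count as collinear. \<open>sym1\<close> and
  \<open>sym2\<close> generate all permutations, and \<open>col_trans\<close> says that two distinct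
  points span a single line.\<close>

locale linear_space =
  fixes R :: "'a set" and col :: "'a \<Rightarrow> 'a \<Rightarrow> 'a \<Rightarrow> bool"
  assumes finR: "finite R"
    and sym1: "col x y z \<Longrightarrow> col y x z"
    and sym2: "col x y z \<Longrightarrow> col x z y"
    and degen: "col x x y"
    and col_trans: "\<lbrakk>x \<in> R; y \<in> R; u \<in> R; v \<in> R; x \<noteq> y; col x y u; col x y v\<rbrakk> \<Longrightarrow> col x u v"
begin

lemma degenerate: "col x x y" "col x y x" "col y x x"
  using degen sym2[OF degen] sym1[OF sym2[OF degen]] by simp_all

definition "line a b = {x \<in> R. col a b x}"
text \<open>Only lines with a third point enter: a two-point line imposes no collinearity, and there
  may be quadratically many of them.\<close>

definition "lines = {line a b | a b. a \<in> R \<and> b \<in> R \<and> a \<noteq> b \<and> (\<exists>c\<in>R. c \<noteq> a \<and> c \<noteq> b \<and> col a b c)}"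

lemma line_col:
  assumes "a \<in> R" "b \<in> R" "a \<noteq> b" "x \<in> line a b" "y \<in> line a b" "z \<in> line a b"
  shows "col x y z"
proof -
  have R: "x \<in> R" "y \<in> R" "z \<in> R" using assms by (auto simp: line_def)
  have c: "col a x y" "col a x z" "col a y z"
    using assms col_trans[of a b] by (auto simp: line_def)
  show ?thesis
  proof (cases "a = x")
    case True
    then show ?thesis using c by simp
  next
    case False
    then show ?thesis using col_trans[of x a y z] R c assms(1) sym1 by blast
  qed
qed

lemma line_mem: "\<lbrakk>x \<in> R; y \<in> R\<rbrakk> \<Longrightarrow> x \<in> line x y \<and> y \<in> line x y"
  by (simp add: line_def degenerate)

lemma line_eq:
  assumes ab: "a \<in> R" "b \<in> R" "a \<noteq> b" and c: "c \<in> line a b" and d: "d \<in> line a b" and cd: "c \<noteq> d"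
  shows "line c d = line a b"
proof -
  have R: "c \<in> R" "d \<in> R" using c d by (auto simp: line_def)
  have a: "a \<in> line a b" "b \<in> line a b" using line_mem ab by auto
  have sub: "line a b \<subseteq> line c d"
    using line_col[OF ab c d] by (auto simp: line_def)
  moreover have "line c d \<subseteq> line a b"
  proof
    fix z assume z: "z \<in> line c d"
    then have "col a b z" using line_col[OF R cd _ _ z, of a b] sub a by auto
    then show "z \<in> line a b" using z by (auto simp: line_def)
  qed
  ultimately show ?thesis by simp
qed

end

locale triangle_free_plane = linear_space R col
  for R :: "'a set" and col :: "'a \<Rightarrow> 'a \<Rightarrow> 'a \<Rightarrow> bool" +
  assumes no_triangle: "\<lbrakk>a \<in> R; b \<in> R; c \<in> R; d \<in> R; e \<in> R; f \<in> R; b \<noteq> a; b \<noteq> c; d \<noteq> c; d \<noteq> e;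
      f \<noteq> e; f \<noteq> a; col a b c; col c d e; col e f a\<rbrakk> \<Longrightarrow> col a c e"
begin

lemma lines_sub: "l \<in> lines \<Longrightarrow> l \<subseteq> R"
  by (auto simp: lines_def line_def)

lemma finite_lines: "finite lines"
  by (rule finite_subset[of _ "Pow R"]) (use lines_sub finR in auto)

lemma lines_eq_line: "\<lbrakk>l \<in> lines; x \<in> l; y \<in> l; x \<noteq> y\<rbrakk> \<Longrightarrow> l = line x y"
  unfolding lines_def using line_eq by blast

lemma lines_unique: "\<lbrakk>l \<in> lines; l' \<in> lines; x \<in> l; y \<in> l; x \<in> l'; y \<in> l'; x \<noteq> y\<rbrakk> \<Longrightarrow> l = l'"
  using lines_eq_line by metis

lemma lines_three:
  assumes "l \<in> lines"
  shows "\<exists>x y z. x \<in> l \<and> y \<in> l \<and> z \<in> l \<and> x \<noteq> y \<and> x \<noteq> z \<and> y \<noteq> z"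
proof -
  obtain a b c where "l = line a b" "a \<in> R" "b \<in> R" "a \<noteq> b" "c \<in> R" "c \<noteq> a" "c \<noteq> b" "col a b c"
    using assms by (auto simp: lines_def)
  moreover from this have "a \<in> l" "b \<in> l" "c \<in> l" using line_mem by (auto simp: line_def)
  ultimately show ?thesis by metis
qed

lemma lines_third:
  assumes "l \<in> lines" "x \<in> l" "y \<in> l" "x \<noteq> y"
  shows "\<exists>w\<in>R. w \<noteq> x \<and> w \<noteq> y \<and> col x w y"
proof -
  obtain w where w: "w \<in> l" "w \<noteq> x" "w \<noteq> y" using lines_three[OF assms(1)] by metis
  then have "w \<in> line x y" using lines_eq_line[OF assms] by simp
  then show ?thesis using w sym2 by (auto simp: line_def)
qed

text \<open>Every member of \<open>lines\<close> has at least three points, so each side supplies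
  the extra point that \<open>no_triangle\<close> asks for.\<close>

lemma triangle_col:
  assumes "l1 \<in> lines" "x \<in> l1" "y \<in> l1" "l2 \<in> lines" "y \<in> l2" "z \<in> l2" "l3 \<in> lines" "x \<in> l3" "z \<in> l3"
  shows "col x y z"
proof (cases "x = y \<or> y = z \<or> x = z")
  case True
  then show ?thesis by (auto simp: degenerate)
next
  case False
  obtain w1 w2 w3 where "w1 \<in> R" "w1 \<noteq> x" "w1 \<noteq> y" "col x w1 y"
    "w2 \<in> R" "w2 \<noteq> y" "w2 \<noteq> z" "col y w2 z" "w3 \<in> R" "w3 \<noteq> z" "w3 \<noteq> x" "col z w3 x"
    using lines_third[OF assms(1-3)] lines_third[OF assms(4-6)] lines_third[OF assms(7,9,8)] False by metis
  moreover have "x \<in> R" "y \<in> R" "z \<in> R" using assms lines_sub by auto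
  ultimately show ?thesis using no_triangle[of x w1 y w2 z w3] by blast
qed

lemma exists_triples:
  "\<exists>p q r. \<forall>l\<in>lines. p l \<in> l \<and> q l \<in> l \<and> r l \<in> l \<and> p l \<noteq> q l \<and> p l \<noteq> r l \<and> q l \<noteq> r l"
proof -
  have "\<forall>l\<in>lines. \<exists>t. fst t \<in> l \<and> fst (snd t) \<in> l \<and> snd (snd t) \<in> l \<and> fst t \<noteq> fst (snd t) \<and>
    fst t \<noteq> snd (snd t) \<and> fst (snd t) \<noteq> snd (snd t)"
    using lines_three by fastforce
  then obtain t where "\<forall>l\<in>lines. fst (t l) \<in> l \<and> fst (snd (t l)) \<in> l \<and> snd (snd (t l)) \<in> l \<and> fst (t l) \<noteq> fst (snd (t l)) \<and>
    fst (t l) \<noteq> snd (snd (t l)) \<and> fst (snd (t l)) \<noteq> snd (snd (t l))" by metis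
  then show ?thesis
    by (intro exI[of _ "fst \<circ> t"] exI[of _ "fst \<circ> (snd \<circ> t)"] exI[of _ "snd \<circ> (snd \<circ> t)"]) simp
qed

text \<open>Two points determine a line, which gives the uniqueness axioms. For
  \<open>closed\<close>, the three points are pairwise joined by members of \<open>lines\<close>,
  hence collinear by \<open>triangle_col\<close>; the three lines then coincide and yield one
  triple. The vertex set may exceed \<open>R\<close>, so that a size threshold can be put on
  \<open>V\<close> alone.\<close>

lemma triangle_free_triples_lines:
  assumes pqr: "\<forall>l\<in>lines. p l \<in> l \<and> q l \<in> l \<and> r l \<in> l \<and> p l \<noteq> q l \<and> p l \<noteq> r l \<and> q l \<noteq> r l"
    and V: "R \<subseteq> V" "finite V"
  shows "triangle_free_triples V ((\<lambda>l. (p l, q l, r l)) ` lines)" (is "triangle_free_triples V ?T")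
proof
  show "finite V" by (rule V)
  have mem: "\<exists>l\<in>lines. x = p l \<and> y = q l \<and> z = r l \<and> x \<in> l \<and> y \<in> l \<and> z \<in> l \<and> x \<noteq> y \<and> x \<noteq> z \<and> y \<noteq> z"
    if "(x, y, z) \<in> ?T" for x y z
    using that pqr by auto
  show "?T \<subseteq> V \<times> V \<times> V"
  proof (rule subsetI)
    fix t assume "t \<in> ?T"
    moreover obtain x y z where "t = (x, y, z)" by (cases t)
    ultimately show "t \<in> V \<times> V \<times> V" using mem[of x y z] lines_sub V(1)
      by (metis mem_Sigma_iff subsetD)
  qed
  show "z = z'" if "(x, y, z) \<in> ?T" "(x, y, z') \<in> ?T" for x y z z'
    using mem[OF that(1)] mem[OF that(2)] lines_unique by metis
  show "y = y'" if "(x, y, z) \<in> ?T" "(x, y', z) \<in> ?T" for x y y' z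
    using mem[OF that(1)] mem[OF that(2)] lines_unique by metis
  show "x = x'" if "(x, y, z) \<in> ?T" "(x', y, z) \<in> ?T" for x x' y z
    using mem[OF that(1)] mem[OF that(2)] lines_unique by metis
  show "(x, y, z) \<in> ?T" if t: "(x, y', z) \<in> ?T" "(x', y, z) \<in> ?T" "(x, y, z') \<in> ?T" for x y z x' y' z'
  proof -
    obtain l1 where l1: "l1 \<in> lines" "x = p l1" "z = r l1" using t(1) by auto
    obtain l2 where l2: "l2 \<in> lines" "y = q l2" "z = r l2" using t(2) by auto
    obtain l3 where l3: "l3 \<in> lines" "x = p l3" "y = q l3" using t(3) by auto
    have m: "x \<in> l1" "z \<in> l1" "y \<in> l2" "z \<in> l2" "x \<in> l3" "y \<in> l3" "x \<noteq> z" "y \<noteq> z" "x \<noteq> y"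
      using bspec[OF pqr l1(1)] bspec[OF pqr l2(1)] bspec[OF pqr l3(1)]
      unfolding l1(3)[symmetric] l1(2)[symmetric] l2(2)[symmetric] l2(3)[symmetric] l3(2)[symmetric] l3(3)[symmetric]
      by auto
    have "col x y z" using triangle_col[of l3 x y l2 z l1] l1 l2 l3 m by blast
    moreover have "z \<in> R" using m l1 lines_sub by blast
    ultimately have "z \<in> l3" using lines_eq_line[OF l3(1) m(5,6,9)] by (auto simp: line_def)
    then have "l1 = l3" using lines_unique[of l1 l3 x z] l1 l3 m by blast
    moreover have "l2 = l3" using \<open>z \<in> l3\<close> lines_unique[of l2 l3 y z] l2 l3 m by blast
    ultimately have "(x, y, z) = (p l3, q l3, r l3)" using l1 l2 l3 by simp
    then show ?thesis using l3(1) by (rule image_eqI)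
  qed
qed

lemma sum_card_lines_pairs: "(\<Sum>l\<in>lines. card l * (card l - 1)) \<le> (card R)\<^sup>2"
proof -
  have finl: "finite l" if "l \<in> lines" for l using that lines_sub finR finite_subset by blast
  let ?P = "\<lambda>l. Sigma l (\<lambda>x. l - {x})"
  have "(\<Sum>l\<in>lines. card l * (card l - 1)) = (\<Sum>l\<in>lines. card (?P l))"
    using finl by (intro sum.cong) auto
  also have "\<dots> = card (\<Union>l\<in>lines. ?P l)"
    by (rule card_UN_disjoint[symmetric]) (use finite_lines finl lines_unique in \<open>auto, blast+\<close>)
  also have "\<dots> \<le> card (R \<times> R)"
    using finR lines_sub by (intro card_mono) auto
  finally show ?thesis by (simp add: card_cartesian_product power2_eq_square)
qed

text \<open>Ruzsa-Szemeredi bounds the number of lines, while the encoding needs the number of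
  incidences. Lines with at most \<open>K\<close> points cost \<open>K\<close> each; a longer one
  satisfies \<open>K * card l \<le> 2 * card l * (card l - 1)\<close>, and an ordered pair of
  distinct points lies on at most one line.\<close>

lemma sum_card_lines:
  fixes K :: real
  assumes K: "K > 0"
  shows "(\<Sum>l\<in>lines. real (card l)) \<le> K * card lines + 2 / K * (real (card R))\<^sup>2"
proof -
  have "real (card l) \<le> K + 2 / K * (card l * (card l - 1))" if l: "l \<in> lines" for l
  proof (cases "card l \<le> K")
    case True
    have "0 \<le> 2 / K * real (card l * (card l - 1))" using K by simp
    then show ?thesis using True by linarith
  next
    case False
    have finl: "finite l" using l lines_sub finR finite_subset by blast
    obtain x y where xy: "x \<in> l" "y \<in> l" "x \<noteq> y" using lines_three[OF l] by blast
    then have "card {x, y} \<le> card l" using finl by (intro card_mono) auto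
    then have two: "card l \<ge> 2" using xy by simp
    have "K * real (card l) \<le> real (card l) * real (card l)" using False by (intro mult_right_mono) auto
    also have "\<dots> \<le> real (card l) * (2 * real (card l - 1))" using two by (intro mult_left_mono) auto
    finally have "real (card l) \<le> 2 / K * (card l * (card l - 1))" using K by (simp add: field_simps)
    then show ?thesis using K by simp
  qed
  then have "(\<Sum>l\<in>lines. real (card l)) \<le> (\<Sum>l\<in>lines. K + 2 / K * (card l * (card l - 1)))"
    by (rule sum_mono)
  also have "\<dots> = K * card lines + 2 / K * (\<Sum>l\<in>lines. card l * (card l - 1))"
    by (simp add: sum.distrib sum_distrib_left)
  also have "\<dots> \<le> K * card lines + 2 / K * (real (card R))\<^sup>2"
  proof -
    have "real (\<Sum>l\<in>lines. card l * (card l - 1)) \<le> (real (card R))\<^sup>2"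
      using sum_card_lines_pairs by (metis of_nat_le_iff of_nat_power)
    then show ?thesis using K by (intro add_left_mono mult_left_mono) auto
  qed
  finally show ?thesis .
qed

end

text \<open>A collinearity relation is recovered from the union of the sets \<open>{p, q} \<times> l\<close>, where \<open>p\<close>, \<open>q\<close>
  are two chosen points of the line \<open>l\<close> and \<open>l\<close> ranges over the lines with at least three points.\<close>
definition decode_col :: "('a \<times> 'a) set \<Rightarrow> 'a \<Rightarrow> 'a \<Rightarrow> 'a \<Rightarrow> bool" where
  "decode_col S x y z \<longleftrightarrow> x = y \<or> y = z \<or> x = z \<or> (\<exists>a b. a \<noteq> b \<and> {a, b} \<times> {a, b, x, y, z} \<subseteq> S)"

text \<open>\<open>S\<close> forgets which pair came from which line. This creates no false
  collinearity: if \<open>a\<close>, \<open>b\<close> and \<open>u\<close> are pairwise related by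
  \<open>S\<close>, they are pairwise joined by members of \<open>lines\<close>, so
  \<open>triangle_col\<close> puts \<open>u\<close> on the line through \<open>a\<close> and
  \<open>b\<close>.\<close>

lemma (in triangle_free_plane) decode_col_iff:
  assumes pqr: "\<forall>l\<in>lines. p l \<in> l \<and> q l \<in> l \<and> p l \<noteq> q l"
    and S: "S = (\<Union>l\<in>lines. {p l, q l} \<times> l)"
    and R: "x \<in> R" "y \<in> R" "z \<in> R"
  shows "col x y z \<longleftrightarrow> decode_col S x y z"
proof (cases "x = y \<or> y = z \<or> x = z")
  case True
  then show ?thesis by (auto simp: decode_col_def degenerate)
next
  case False
  show ?thesis
  proof
    assume c: "col x y z"
    let ?l = "line x y"
    have "\<exists>c\<in>R. c \<noteq> x \<and> c \<noteq> y \<and> col x y c" using c R(3) False by (intro bexI[of _ z]) auto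
    then have l: "?l \<in> lines" using R(1,2) False unfolding lines_def by blast
    have "{p ?l, q ?l} \<times> ?l \<subseteq> S" using l unfolding S by blast
    moreover have "{p ?l, q ?l, x, y, z} \<subseteq> ?l" using pqr l c R line_mem by (auto simp: line_def)
    ultimately have "{p ?l, q ?l} \<times> {p ?l, q ?l, x, y, z} \<subseteq> S" by blast
    then show "decode_col S x y z"
      unfolding decode_col_def using pqr l by blast
  next
    assume "decode_col S x y z"
    then obtain a b where ab: "a \<noteq> b" "{a, b} \<times> {a, b, x, y, z} \<subseteq> S"
      using False unfolding decode_col_def by blast
    have on: "\<exists>l\<in>lines. u \<in> l \<and> v \<in> l" if "(u, v) \<in> S" for u v
      using that pqr unfolding S by auto
    have abR: "a \<in> R" "b \<in> R" using ab(2) on lines_sub by blast+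
    have "u \<in> line a b" if u: "u \<in> {x, y, z}" for u
    proof -
      have "(a, b) \<in> S" "(a, u) \<in> S" "(b, u) \<in> S" using ab(2) u by auto
      then have "col a b u" using on triangle_col by metis
      then show ?thesis using u R by (auto simp: line_def)
    qed
    then show "col x y z" using line_col[OF abR ab(1)] by auto
  qed
qed

theorem sparse_encoding:
  fixes e :: real
  assumes e: "0 < e"
  shows "\<exists>N. \<forall>(V :: 'a set) R col. finite V \<and> R \<subseteq> V \<and> card V \<ge> N \<and> triangle_free_plane R col \<longrightarrow>
    (\<exists>S \<subseteq> V \<times> V. card S \<le> e * (real (card V))\<^sup>2 \<and>
      (\<forall>x\<in>R. \<forall>y\<in>R. \<forall>z\<in>R. col x y z \<longleftrightarrow> decode_col S x y z))"
proof -
  \<comment> \<open>The constant fits \<open>sum_card_lines\<close> at \<open>K = 8 / e\<close>: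
    after doubling for the two chosen points of each line, both of its terms come to
    \<open>e / 2\<close> times the square of \<open>card V\<close>.\<close>
  obtain N where N: "\<And>(V :: 'a set) T. triangle_free_triples V T \<Longrightarrow> card V \<ge> N \<Longrightarrow>
      card T \<le> e\<^sup>2 / 32 * (real (card V))\<^sup>2"
    using ruzsa_szemeredi[of "e\<^sup>2 / 32"] e by auto
  have "\<exists>S \<subseteq> V \<times> V. card S \<le> e * (real (card V))\<^sup>2 \<and>
      (\<forall>x\<in>R. \<forall>y\<in>R. \<forall>z\<in>R. col x y z \<longleftrightarrow> decode_col S x y z)"
    if V: "finite V" "R \<subseteq> V" "card V \<ge> N" and pl: "triangle_free_plane R col" for V R :: "'a set" and col
  proof -
    interpret triangle_free_plane R col by (rule pl)
    obtain p q r where pqr: "\<forall>l\<in>lines. p l \<in> l \<and> q l \<in> l \<and> r l \<in> l \<and> p l \<noteq> q l \<and> p l \<noteq> r l \<and> q l \<noteq> r l"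
      using exists_triples by blast
    let ?T = "(\<lambda>l. (p l, q l, r l)) ` lines"
    have "inj_on (\<lambda>l. (p l, q l, r l)) lines"
    proof (rule inj_onI)
      fix l l' assume "l \<in> lines" "l' \<in> lines" "(p l, q l, r l) = (p l', q l', r l')"
      then show "l = l'" using pqr lines_unique[of l l' "p l" "q l"] by auto
    qed
    then have "card lines = card ?T" by (simp add: card_image)
    also have "real \<dots> \<le> e\<^sup>2 / 32 * (real (card V))\<^sup>2"
      by (rule N[OF triangle_free_triples_lines[OF pqr V(2,1)] V(3)])
    finally have cl: "card lines \<le> e\<^sup>2 / 32 * (real (card V))\<^sup>2" .
    define S where "S = (\<Union>l\<in>lines. {p l, q l} \<times> l)"
    have "card S \<le> (\<Sum>l\<in>lines. card ({p l, q l} \<times> l))"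
      unfolding S_def by (rule card_UN_le[OF finite_lines])
    also have "\<dots> = (\<Sum>l\<in>lines. 2 * card l)"
      using pqr by (intro sum.cong) (auto simp: card_cartesian_product)
    finally have "real (card S) \<le> real (\<Sum>l\<in>lines. 2 * card l)" by linarith
    also have "\<dots> = 2 * (\<Sum>l\<in>lines. real (card l))" by (simp add: sum_distrib_left)
    also have "\<dots> \<le> 2 * (8 / e * card lines + 2 / (8 / e) * (real (card R))\<^sup>2)"
      using sum_card_lines[of "8 / e"] e by simp
    also have "\<dots> \<le> 2 * (8 / e * (e\<^sup>2 / 32 * (real (card V))\<^sup>2) + 2 / (8 / e) * (real (card V))\<^sup>2)"
      using e cl V card_mono[OF V(1,2)] by (intro mult_left_mono add_mono power_mono) auto
    also have "\<dots> = e * (real (card V))\<^sup>2" using e by (simp add: power2_eq_square)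
    finally have "card S \<le> e * (real (card V))\<^sup>2" .
    moreover have "S \<subseteq> V \<times> V" using pqr lines_sub V unfolding S_def by blast
    moreover have "\<forall>x\<in>R. \<forall>y\<in>R. \<forall>z\<in>R. col x y z \<longleftrightarrow> decode_col S x y z"
      using decode_col_iff[OF _ S_def] pqr by blast
    ultimately show ?thesis by blast
  qed
  then show ?thesis by blast
qed

section \<open>Matroids of rank 3\<close>

lemma
  assumes "matroid V Ind"
  shows matroid_finite: "finite V"
    and matroid_carrier: "X \<in> Ind \<Longrightarrow> X \<subseteq> V"
    and matroid_empty: "{} \<in> Ind"
    and matroid_subset: "\<lbrakk>X \<in> Ind; Y \<subseteq> X\<rbrakk> \<Longrightarrow> Y \<in> Ind"
    and matroid_exchange: "\<lbrakk>X \<in> Ind; Y \<in> Ind; card X < card Y\<rbrakk> \<Longrightarrow> \<exists>y\<in>Y - X. insert y X \<in> Ind"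
  using assms unfolding matroid_def by meson+

lemma matroid_augment:
  assumes M: "matroid V Ind" and XY: "X \<in> Ind" "Y \<in> Ind" "card X \<le> card Y"
  shows "\<exists>Z \<in> Ind. X \<subseteq> Z \<and> Z \<subseteq> X \<union> Y \<and> card Z = card Y"
  using XY
proof (induction "card Y - card X" arbitrary: X)
  case 0
  then show ?case by (intro bexI[of _ X]) auto
next
  case (Suc k)
  then have "card X < card Y" by linarith
  then obtain y where y: "y \<in> Y - X" "insert y X \<in> Ind"
    using matroid_exchange[OF M Suc.prems(1,2)] by blast
  have "finite X" 
    using matroid_finite[OF M] matroid_carrier[OF M Suc.prems(1)] by (rule rev_finite_subset)
  then have c: "card (insert y X) = Suc (card X)" using y(1) by simp
  obtain Z where "Z \<in> Ind" "insert y X \<subseteq> Z" "Z \<subseteq> insert y X \<union> Y" "card Z = card Y"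
    using Suc.hyps(1)[of "insert y X"] Suc.hyps(2) Suc.prems y(2) c \<open>card X < card Y\<close> by force
  then show ?case using y(1) by (intro bexI[of _ Z]) auto
qed

definition hexagon_lines :: "nat set set" where
  "hexagon_lines = {{1,2,3}, {3,4,5}, {5,6,1}, {2,4,6}}"

definition hexagon_bases :: "nat set set" where
  "hexagon_bases = {{1,3,5}, {1,2,4}, {1,2,5}, {1,2,6}, {1,3,4}, {1,3,6}, {1,4,5}, {1,4,6}, {2,3,4}, {2,3,5},
    {2,3,6}, {2,4,5}, {2,5,6}, {3,4,6}, {3,5,6}, {4,5,6}}"

text \<open>Independence passes to subsets, so an embedding of six points only has to be checked on
  the sixteen triples of \<open>hexagon_bases\<close>.\<close>

lemma hexagon_subsets:
  "\<forall>X \<in> Pow {1, 2, 3, 4, 5, 6}. card X \<le> 3 \<longrightarrow> X \<in> hexagon_lines \<or> (\<exists>Y \<in> hexagon_bases. X \<subseteq> Y)"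
  by code_simp

text \<open>Neither the rank-3 whirl nor \<open>M(K\<^sub>4)\<close> embeds: the set \<open>g ` {2, 4, 6}\<close> is left unconstrained.\<close>
locale hexagon_free_matroid =
  fixes V :: "'a set" and Ind :: "'a set set"
  assumes mat: "matroid V Ind"
    and no_hexagon: "\<lbrakk>inj_on g {1..6::nat}; g ` {1..6} \<subseteq> V;
      \<And>X. \<lbrakk>X \<subseteq> {1..6}; card X \<le> 3; X \<notin> hexagon_lines\<rbrakk> \<Longrightarrow> g ` X \<in> Ind;
      g ` {1,2,3} \<notin> Ind; g ` {3,4,5} \<notin> Ind; g ` {5,6,1} \<notin> Ind\<rbrakk> \<Longrightarrow> False"
begin

lemma finV: "finite V" and subV: "X \<in> Ind \<Longrightarrow> X \<subseteq> V" and subset_Ind: "X \<in> Ind \<Longrightarrow> Y \<subseteq> X \<Longrightarrow> Y \<in> Ind"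
  using matroid_finite[OF mat] matroid_carrier[OF mat] matroid_subset[OF mat] by auto

definition "nonloops = {x. {x} \<in> Ind}"
definition "par x y \<longleftrightarrow> x \<in> nonloops \<and> y \<in> nonloops \<and> (x = y \<or> {x, y} \<notin> Ind)"
definition "rep x = (SOME y. par x y)"
text \<open>One point from each parallel class; any two of them are independent, as needed for two
  points to span a line.\<close>

definition "R = rep ` nonloops"
definition "col x y z \<longleftrightarrow> x = y \<or> y = z \<or> x = z \<or> {x, y, z} \<notin> Ind"

lemma nonloops_sub: "nonloops \<subseteq> V"
  using subV by (auto simp: nonloops_def)

lemma par_refl: "x \<in> nonloops \<Longrightarrow> par x x"
  and par_sym: "par x y \<Longrightarrow> par y x"
  by (auto simp: par_def insert_commute)

text \<open>Otherwise \<open>{x, z}\<close> is independent, and augmenting \<open>{y}\<close> from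
  it makes \<open>y\<close> independent of \<open>x\<close> or of \<open>z\<close>.\<close>

lemma par_trans:
  assumes "par x y" "par y z"
  shows "par x z"
proof (rule ccontr)
  assume n: "\<not> par x z"
  then have xz: "{x, z} \<in> Ind" "x \<noteq> z" using assms by (auto simp: par_def)
  obtain Z where Z: "Z \<in> Ind" "{y} \<subseteq> Z" "Z \<subseteq> {y} \<union> {x, z}" "card Z = card {x, z}"
    using matroid_augment[OF mat, of "{y}" "{x, z}"] assms xz by (auto simp: par_def nonloops_def)
  have "Z \<noteq> {y}" using Z(4) xz(2) by auto
  then have "(x \<noteq> y \<and> {x, y} \<subseteq> Z) \<or> (z \<noteq> y \<and> {y, z} \<subseteq> Z)" using Z(2,3) by blast
  then show False using assms subset_Ind[OF Z(1)] by (auto simp: par_def)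
qed

lemma par_rep: "x \<in> nonloops \<Longrightarrow> par x (rep x)"
  unfolding rep_def using par_refl by (rule someI)

lemma rep_eq:
  assumes "par x y"
  shows "rep x = rep y"
proof -
  have "par x z \<longleftrightarrow> par y z" for z
    using par_trans[OF assms] par_trans[OF par_sym[OF assms]] by blast
  then have "par x = par y" by blast
  then show ?thesis by (simp add: rep_def)
qed

lemma R_sub: "R \<subseteq> nonloops"
  using par_rep by (auto simp: R_def par_def)

lemma R_indep:
  assumes "x \<in> R" "y \<in> R"
  shows "{x, y} \<in> Ind"
proof (cases "x = y")
  case True
  then show ?thesis using assms R_sub by (auto simp: nonloops_def)
next
  case False
  obtain a b where ab: "a \<in> nonloops" "x = rep a" "b \<in> nonloops" "y = rep b" using assms by (auto simp: R_def)
  have "rep x = x" "rep y = y" using ab rep_eq[OF par_rep] by metis+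
  then have "\<not> par x y" using rep_eq[of x y] False by metis
  then show ?thesis using assms R_sub by (auto simp: par_def)
qed

text \<open>For \<open>col_trans\<close>, augment the independent pair \<open>{x, y}\<close> from an
  independent \<open>{x, u, v}\<close>: the new element is \<open>u\<close> or \<open>v\<close>,
  contradicting one of the two collinearities.\<close>

lemma linear_space_col: "linear_space R col"
proof
  show "finite R" by (rule finite_subset[OF order_trans[OF R_sub nonloops_sub] finV])
  show "col x y z \<Longrightarrow> col y x z" "col x y z \<Longrightarrow> col x z y" "col x x y" for x y z
    by (auto simp: col_def insert_commute)
  show "col x u v" if h: "x \<in> R" "y \<in> R" "u \<in> R" "v \<in> R" "x \<noteq> y" "col x y u" "col x y v" for x y u v
  proof (rule ccontr)
    assume n: "\<not> col x u v"
    then have I: "{x, u, v} \<in> Ind" "card {x, u, v} = 3" by (auto simp: col_def)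
    obtain Z where Z: "Z \<in> Ind" "{x, y} \<subseteq> Z" "Z \<subseteq> {x, y} \<union> {x, u, v}" "card Z = 3"
      using matroid_augment[OF mat R_indep[OF h(1,2)] I(1)] I(2) h(5) by auto
    have "Z \<noteq> {x, y}" using Z(4) h(5) by auto
    then obtain w where w: "w \<in> Z" "w \<noteq> x" "w \<noteq> y" using Z(2) by auto
    then have "{x, y, w} \<in> Ind" using Z by (intro subset_Ind[OF Z(1)]) auto
    moreover have "w = u \<or> w = v" using w Z(3) by auto
    ultimately show False using h w by (auto simp: col_def)
  qed
qed

interpretation linear_space R col by (rule linear_space_col)

text \<open>A violation of \<open>no_triangle\<close> is an embedded hexagon. Starting from the
  noncollinear corners \<open>a\<close>, \<open>c\<close>, \<open>e\<close>, points are moved along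
  the sides until every triple other than the sides and \<open>b\<close>, \<open>d\<close>,
  \<open>f\<close> is known to be noncollinear.\<close>

lemma triangle_free_plane_col: "triangle_free_plane R col"
proof (unfold_locales, rule ccontr)
  fix a b c d e f
  assume R: "a \<in> R" "b \<in> R" "c \<in> R" "d \<in> R" "e \<in> R" "f \<in> R"
    and ne: "b \<noteq> a" "b \<noteq> c" "d \<noteq> c" "d \<noteq> e" "f \<noteq> e" "f \<noteq> a"
    and l: "col a b c" "col c d e" "col e f a" and n: "\<not> col a c e"
  \<comment> \<open>A point \<open>y'\<close> other than \<open>x\<close> on the line through
    \<open>x\<close> and \<open>y\<close> spans the same line with \<open>x\<close>, so
    \<open>s\<close> stays off it.\<close>
  have slide: "\<not> col x y' s" if "\<not> col x y s" "col x y y'" "y' \<noteq> x" "x \<in> R" "y \<in> R" "y' \<in> R" "s \<in> R" for x y y' s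
    using that col_trans[of x y' y s] sym2[of x y y'] by blast
  have rot: "col x y z \<longleftrightarrow> col y z x" "col x y z \<longleftrightarrow> col y x z" for x y z
    using sym1 sym2 by blast+
  have l': "col a c b" "col c a b" "col c e d" "col e c d" "col e a f" "col a e f"
    using l rot by blast+
  have abe: "\<not> col a b e" using slide[OF n l'(1)] ne R by blast
  have cbe: "\<not> col c b e" using slide[of c a e b] l'(2) n ne R rot by blast
  have cda: "\<not> col c d a" using slide[of c e a d] l'(3) n ne R rot by blast
  have eda: "\<not> col e d a" using slide[of e c a d] l'(4) n ne R rot by blast
  have efc: "\<not> col e f c" using slide[of e a c f] l'(5) n ne R rot by blast
  have afc: "\<not> col a f c" using slide[of a e c f] l'(6) n ne R rot by blast
  have abf: "\<not> col a b f" using slide[of a c f b] l'(1) afc ne R rot by blast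
  have abd: "\<not> col a b d" using slide[of a c d b] l'(1) cda ne R rot by blast
  have cbd: "\<not> col c b d" using slide[of c a d b] l'(2) cda ne R rot by blast
  have cbf: "\<not> col c b f" using slide[of c a f b] l'(2) afc ne R rot by blast
  have cdf: "\<not> col c d f" using slide[of c e f d] l'(3) efc ne R rot by blast
  have edf: "\<not> col e d f" using slide[of e c f d] l'(4) efc ne R rot by blast
  have edb: "\<not> col e d b" using slide[of e c b d] l'(4) cbe ne R rot by blast
  have efb: "\<not> col e f b" using slide[of e a b f] l'(5) abe ne R rot by blast
  have afd: "\<not> col a f d" using slide[of a e d f] l'(6) eda ne R rot by blast
  note all = n abe cbe cda eda efc afc abf abd cbd cbf cdf edf edb efb afd
  have "a \<noteq> b" "a \<noteq> c" "a \<noteq> d" "a \<noteq> e" "a \<noteq> f" "b \<noteq> c" "b \<noteq> d" "b \<noteq> e" "b \<noteq> f" "c \<noteq> d" "c \<noteq> e" "c \<noteq> f" "d \<noteq> e" "d \<noteq> f" "e \<noteq> f"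
    using all ne by (simp_all add: col_def)
  then have dist: "distinct [a, b, c, d, e, f]" by simp
  have I: "{a, c, e} \<in> Ind" "{a, b, d} \<in> Ind" "{a, b, e} \<in> Ind" "{a, b, f} \<in> Ind" "{a, c, d} \<in> Ind" "{a, c, f} \<in> Ind" "{a, d, e} \<in> Ind" "{a, d, f} \<in> Ind" "{b, c, d} \<in> Ind" "{b, c, e} \<in> Ind" "{b, c, f} \<in> Ind" "{b, d, e} \<in> Ind" "{b, e, f} \<in> Ind" "{c, d, f} \<in> Ind" "{c, e, f} \<in> Ind" "{d, e, f} \<in> Ind"
    using all by (simp_all add: col_def insert_commute)
  define g :: "nat \<Rightarrow> 'a" where "g i = (if i = 1 then a else if i = 2 then b else if i = 3 then c else
    if i = 4 then d else if i = 5 then e else f)" for i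
  have g: "g 1 = a" "g 2 = b" "g 3 = c" "g 4 = d" "g 5 = e" "g 6 = f" "g (Suc 0) = a" by (simp_all add: g_def)
  have iv: "{1..6::nat} = {1, 2, 3, 4, 5, 6}" by auto
  show False
  proof (rule no_hexagon[of g])
    show "inj_on g {1..6}" unfolding iv using dist by (simp add: g inj_on_def) blast
    show "g ` {1..6} \<subseteq> V" unfolding iv using R R_sub nonloops_sub by (auto simp: g)
    show "g ` {1,2,3} \<notin> Ind" "g ` {3,4,5} \<notin> Ind" "g ` {5,6,1} \<notin> Ind"
      using l dist by (auto simp: g col_def)
    fix X assume X: "X \<subseteq> {1..6::nat}" "card X \<le> 3" "X \<notin> hexagon_lines"
    then have "\<exists>Y \<in> hexagon_bases. X \<subseteq> Y"
      using hexagon_subsets unfolding iv by blast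
    moreover have "\<forall>Y \<in> hexagon_bases. g ` Y \<in> Ind"
      using I unfolding hexagon_bases_def by (simp add: g)
    ultimately obtain Y where Y: "X \<subseteq> Y" "g ` Y \<in> Ind" by blast
    from Y(2) show "g ` X \<in> Ind" by (rule subset_Ind) (use Y(1) in auto)
  qed
qed

text \<open>Augmenting \<open>{x'}\<close> from \<open>{x, y, z}\<close> cannot bring in
  \<open>x\<close>, so it must bring in both \<open>y\<close> and \<open>z\<close>.\<close>

lemma par_replace:
  assumes "par x x'" "{x, y, z} \<in> Ind" "card {x, y, z} = 3"
  shows "{x', y, z} \<in> Ind \<and> card {x', y, z} = 3"
proof (cases "x = x'")
  case False
  then have n: "{x, x'} \<notin> Ind" using assms(1) by (auto simp: par_def)
  have x': "{x'} \<in> Ind" using assms(1) by (auto simp: par_def nonloops_def)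
  obtain Z where Z: "Z \<in> Ind" "{x'} \<subseteq> Z" "Z \<subseteq> {x'} \<union> {x, y, z}" "card Z = 3"
    using matroid_augment[OF mat x' assms(2)] assms(3) by auto
  have "x \<notin> Z" using n subset_Ind[OF Z(1), of "{x, x'}"] Z(2) by auto
  then have "Z \<subseteq> {x', y, z}" using Z(3) by auto
  moreover have "card {x', y, z} \<le> 3" by (simp add: card_insert_if)
  ultimately have "Z = {x', y, z}" using Z(4) by (intro card_seteq) auto
  then show ?thesis using Z by simp
qed (use assms in simp)

text \<open>The three points are replaced by their representatives one at a time, with the set
  rotated so that the next point to be replaced stands first.\<close>

lemma basis_iff:
  assumes "x \<in> nonloops" "y \<in> nonloops" "z \<in> nonloops"
  shows "{x, y, z} \<in> Ind \<and> card {x, y, z} = 3 \<longleftrightarrow> \<not> col (rep x) (rep y) (rep z)"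
proof -
  have c3: "\<not> col u v w \<longleftrightarrow> {u, v, w} \<in> Ind \<and> card {u, v, w} = 3" for u v w
    by (auto simp: col_def card_insert_if)
  have step: "{u, v, w} \<in> Ind \<and> card {u, v, w} = 3 \<longleftrightarrow> {u', v, w} \<in> Ind \<and> card {u', v, w} = 3"
    if "par u u'" for u u' v w
    using par_replace[OF that] par_replace[OF par_sym[OF that]] by blast
  have "{x, y, z} \<in> Ind \<and> card {x, y, z} = 3 \<longleftrightarrow> {y, z, rep x} \<in> Ind \<and> card {y, z, rep x} = 3"
    using step[OF par_rep[OF assms(1)], of y z] by (simp add: insert_commute)
  also have "\<dots> \<longleftrightarrow> {z, rep x, rep y} \<in> Ind \<and> card {z, rep x, rep y} = 3"
    using step[OF par_rep[OF assms(2)], of z "rep x"] by (simp add: insert_commute)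
  also have "\<dots> \<longleftrightarrow> {rep x, rep y, rep z} \<in> Ind \<and> card {rep x, rep y, rep z} = 3"
    using step[OF par_rep[OF assms(3)], of "rep x" "rep y"] by (simp add: insert_commute)
  finally show ?thesis unfolding c3 .
qed

end

text \<open>\<open>P\<close> is meant to be the graph of \<open>rep\<close> on the nonloops, which
  records loops and parallel classes; \<open>S\<close> is the code of collinearity among
  representatives.\<close>

definition decode_bases :: "('a \<times> 'a) set \<Rightarrow> ('a \<times> 'a) set \<Rightarrow> 'a set set" where
  "decode_bases P S = {{x, y, z} | x y z. \<exists>x' y' z'. (x, x') \<in> P \<and> (y, y') \<in> P \<and> (z, z') \<in> P \<and>
    \<not> decode_col S x' y' z'}"

lemma (in hexagon_free_matroid) decode_bases_eq:
  assumes S: "\<forall>x\<in>R. \<forall>y\<in>R. \<forall>z\<in>R. col x y z \<longleftrightarrow> decode_col S x y z"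
  shows "{X \<in> Ind. card X = 3} = decode_bases ((\<lambda>x. (x, rep x)) ` nonloops) S" (is "?L = ?R")
proof (intro equalityI subsetI)
  fix X assume X: "X \<in> ?L"
  then obtain x y z where xyz: "X = {x, y, z}" by (auto simp: card_3_iff)
  have n: "x \<in> nonloops" "y \<in> nonloops" "z \<in> nonloops"
    using X xyz by (auto simp: nonloops_def intro: subset_Ind)
  then have "\<not> col (rep x) (rep y) (rep z)" using basis_iff X xyz by auto
  then have "\<not> decode_col S (rep x) (rep y) (rep z)" using S n by (auto simp: R_def)
  then show "X \<in> ?R" unfolding decode_bases_def xyz using n by blast
next
  fix X assume "X \<in> ?R"
  then obtain x y z where xyz: "X = {x, y, z}" "x \<in> nonloops" "y \<in> nonloops" "z \<in> nonloops"
    "\<not> decode_col S (rep x) (rep y) (rep z)" unfolding decode_bases_def by blast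
  then have "\<not> col (rep x) (rep y) (rep z)" using S by (auto simp: R_def)
  then show "X \<in> ?L" using basis_iff xyz by auto
qed

section \<open>Counting sparse relations and the planes they encode\<close>

lemma sum_power_card_Pow:
  fixes x :: real
  assumes "finite A"
  shows "(\<Sum>S\<in>Pow A. x ^ card S) = (1 + x) ^ card A"
  using assms
proof (induction A)
  case (insert a A)
  have fin: "finite S" if "S \<in> Pow A" for S using that insert.hyps finite_subset by auto
  have "(\<Sum>S\<in>Pow (insert a A). x ^ card S) = (\<Sum>S\<in>Pow A. x ^ card S) + (\<Sum>S\<in>insert a ` Pow A. x ^ card S)"
    unfolding Pow_insert using insert.hyps by (intro sum.union_disjoint) auto
  also have "(\<Sum>S\<in>insert a ` Pow A. x ^ card S) = (\<Sum>S\<in>Pow A. x ^ card (insert a S))"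
    using insert.hyps by (subst sum.reindex) (auto intro!: inj_onI)
  also have "\<dots> = (\<Sum>S\<in>Pow A. x * x ^ card S)"
    by (rule sum.cong) (use insert.hyps fin in \<open>auto simp: card_insert_if\<close>)
  finally show ?case using insert by (simp add: algebra_simps flip: sum_distrib_left)
qed simp

text \<open>Exponential-moment bound: the weights \<open>x ^ card S\<close> total
  \<open>(1 + x) ^ card A\<close>, and each small set weighs at least
  \<open>x powr (\<delta> * card A)\<close>. Here \<open>x\<close> is chosen so that the total costs
  \<open>\<eta> / 2\<close> in the exponent, and \<open>\<delta>\<close> so that dividing by the
  weight costs another \<open>\<eta> / 2\<close>.\<close>

lemma card_sparse_subsets:
  fixes \<eta> :: real
  assumes "\<eta> > 0"
  shows "\<exists>\<delta>::real. \<delta> > 0 \<and> (\<forall>A :: 'a set. finite A \<longrightarrow> card {S. S \<subseteq> A \<and> card S \<le> \<delta> * card A} \<le> 2 powr (\<eta> * card A))"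
proof -
  define x where "x = min 1 (2 powr (\<eta> / 2) - 1)"
  have x: "0 < x" "x \<le> 1" "1 + x \<le> 2 powr (\<eta> / 2)"
    using assms by (auto simp: x_def)
  \<comment> \<open>The added 1 keeps \<open>D\<close> positive when \<open>x = 1\<close>.\<close>
  define D where "D = log 2 (1 / x) + 1"
  have D: "D > 0" "log 2 (1 / x) \<le> D" using x by (auto simp: D_def add_nonneg_pos)
  define \<delta> where "\<delta> = (\<eta> / 2) / D"
  have \<delta>: "\<delta> > 0" using assms D by (simp add: \<delta>_def)
  have "card {S. S \<subseteq> A \<and> card S \<le> \<delta> * card A} \<le> 2 powr (\<eta> * card A)" if A: "finite A" for A :: "'a set"
  proof -
    let ?F = "{S. S \<subseteq> A \<and> card S \<le> \<delta> * card A}" and ?n = "real (card A)"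
    have "x powr (\<delta> * ?n) * card ?F = (\<Sum>S\<in>?F. x powr (\<delta> * ?n))" by simp
    also have "\<dots> \<le> (\<Sum>S\<in>?F. x ^ card S)"
    proof (rule sum_mono)
      fix S assume "S \<in> ?F"
      then have "x powr (\<delta> * ?n) \<le> x powr card S" using x by (intro powr_mono') auto
      then show "x powr (\<delta> * ?n) \<le> x ^ card S" using x by (simp add: powr_realpow)
    qed
    also have "\<dots> \<le> (\<Sum>S\<in>Pow A. x ^ card S)"
      using A x by (intro sum_mono2) auto
    also have "\<dots> = (1 + x) ^ card A" by (rule sum_power_card_Pow[OF A])
    also have "\<dots> = (1 + x) powr ?n" using x by (simp add: powr_realpow)
    also have "\<dots> \<le> (2 powr (\<eta> / 2)) powr ?n" using x by (intro powr_mono2) auto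
    also have "\<dots> = 2 powr (\<eta> / 2 * ?n)" by (simp add: powr_powr)
    finally have main: "x powr (\<delta> * ?n) * card ?F \<le> 2 powr (\<eta> / 2 * ?n)" .
    have "\<delta> * log 2 (1 / x) \<le> \<delta> * D" using \<delta> D by (intro mult_left_mono) auto
    also have "\<dots> = \<eta> / 2" using D by (simp add: \<delta>_def)
    finally have "- (\<eta> / 2) \<le> log 2 x * \<delta>" using x by (simp add: log_divide mult.commute)
    then have "- (\<eta> / 2) * ?n \<le> log 2 x * \<delta> * ?n" by (intro mult_right_mono) auto
    then have "2 powr (- (\<eta> / 2) * ?n) \<le> 2 powr (log 2 x * (\<delta> * ?n))" by (simp add: mult.assoc)
    also have "\<dots> = x powr (\<delta> * ?n)" using x by (simp flip: powr_powr)
    finally have "2 powr (- (\<eta> / 2) * ?n) * card ?F \<le> 2 powr (\<eta> / 2 * ?n)"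
      using main by (meson mult_right_mono of_nat_0_le_iff order_trans)
    then have "2 powr (\<eta> / 2 * ?n) * (2 powr (- (\<eta> / 2) * ?n) * card ?F) \<le> 2 powr (\<eta> / 2 * ?n) * 2 powr (\<eta> / 2 * ?n)"
      by (intro mult_left_mono) auto
    then show ?thesis by (simp flip: powr_add mult.assoc)
  qed
  with \<delta> show ?thesis by (intro exI[of _ \<delta>] conjI allI impI)
qed

text \<open>Both arguments of \<open>decode_bases\<close> are sparse: the graph of
  \<open>rep\<close> has at most \<open>card V\<close> pairs, which is a small part of
  \<open>V \<times> V\<close> once \<open>card V\<close> reaches \<open>1 / \<delta>\<close>. Only
  independent triples are recorded because they are all that the traces in Shearer's inequality
  see.\<close>

theorem card_hexagon_free_bases:
  fixes \<eta> :: real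
  assumes "\<eta> > 0"
  shows "\<exists>N. \<forall>V :: 'a set. finite V \<and> card V \<ge> N \<longrightarrow>
    card {{X \<in> Ind. card X = 3} | Ind. hexagon_free_matroid V Ind} \<le> 2 powr (\<eta> * (real (card V))\<^sup>2)"
proof -
  obtain \<delta> :: real where \<delta>: "\<delta> > 0" "\<And>A :: ('a \<times> 'a) set. finite A \<Longrightarrow>
      card {S. S \<subseteq> A \<and> card S \<le> \<delta> * card A} \<le> 2 powr (\<eta> / 2 * card A)"
    using card_sparse_subsets[of "\<eta> / 2", where ?'a = "'a \<times> 'a"] assms by auto
  obtain N where N0: "\<forall>(V :: 'a set) R col. finite V \<and> R \<subseteq> V \<and> card V \<ge> N \<and> triangle_free_plane R col \<longrightarrow>
    (\<exists>S \<subseteq> V \<times> V. card S \<le> \<delta> * (real (card V))\<^sup>2 \<and>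
      (\<forall>x\<in>R. \<forall>y\<in>R. \<forall>z\<in>R. col x y z \<longleftrightarrow> decode_col S x y z))"
    using sparse_encoding[OF \<delta>(1), where ?'a = 'a] by (rule exE)
  have N: "\<exists>S \<subseteq> V \<times> V. card S \<le> \<delta> * (real (card V))\<^sup>2 \<and>
      (\<forall>x\<in>R. \<forall>y\<in>R. \<forall>z\<in>R. col x y z \<longleftrightarrow> decode_col S x y z)"
    if "finite V" "R \<subseteq> V" "card V \<ge> N" "triangle_free_plane R col" for V R :: "'a set" and col
    using N0[rule_format, OF conjI[OF that(1) conjI[OF that(2) conjI[OF that(3,4)]]]] .
  have "card {{X \<in> Ind. card X = 3} | Ind. hexagon_free_matroid V Ind} \<le> 2 powr (\<eta> * (real (card V))\<^sup>2)"
    if V: "finite V" "card V \<ge> max N (nat \<lceil>1 / \<delta>\<rceil>)" for V :: "'a set"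
  proof -
    let ?n = "real (card V)"
    let ?F = "{S. S \<subseteq> V \<times> V \<and> card S \<le> \<delta> * card (V \<times> V)}"
    have sq: "real (card (V \<times> V)) = ?n\<^sup>2" by (simp add: card_cartesian_product power2_eq_square)
    have finF: "finite ?F" using V by (intro finite_subset[of ?F "Pow (V \<times> V)"]) auto
    have "?n \<ge> 1 / \<delta>" using V(2) by linarith
    then have "1 \<le> \<delta> * ?n" using \<delta>(1) by (simp add: field_simps)
    then have "?n * 1 \<le> ?n * (\<delta> * ?n)" by (intro mult_left_mono) auto
    then have n_le: "?n \<le> \<delta> * ?n\<^sup>2" by (simp add: power2_eq_square mult_ac)
    have "{{X \<in> Ind. card X = 3} | Ind. hexagon_free_matroid V Ind} \<subseteq> (\<lambda>(P, S). decode_bases P S) ` (?F \<times> ?F)"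
    proof safe
      fix Ind assume "hexagon_free_matroid V Ind"
      then interpret hexagon_free_matroid V Ind .
      have "R \<subseteq> V" using R_sub nonloops_sub by blast
      then obtain S where S: "S \<subseteq> V \<times> V" "card S \<le> \<delta> * ?n\<^sup>2"
        "\<forall>x\<in>R. \<forall>y\<in>R. \<forall>z\<in>R. col x y z \<longleftrightarrow> decode_col S x y z"
        using N[OF V(1) _ _ triangle_free_plane_col] V(2) by auto
      let ?P = "(\<lambda>x. (x, rep x)) ` nonloops"
      have "card ?P \<le> card V"
        using card_image_le[OF finite_subset[OF nonloops_sub V(1)]] card_mono[OF V(1) nonloops_sub]
        by (rule order_trans)
      then have "real (card ?P) \<le> \<delta> * ?n\<^sup>2" using n_le by linarith
      moreover have "?P \<subseteq> V \<times> V" using nonloops_sub \<open>R \<subseteq> V\<close> by (auto simp: R_def)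
      ultimately have "(?P, S) \<in> ?F \<times> ?F" using S unfolding sq by simp
      then show "{X \<in> Ind. card X = 3} \<in> (\<lambda>(P, S). decode_bases P S) ` (?F \<times> ?F)"
        by (rule rev_image_eqI) (simp add: decode_bases_eq[OF S(3)])
    qed
    then have "card {{X \<in> Ind. card X = 3} | Ind. hexagon_free_matroid V Ind} \<le> card (?F \<times> ?F)"
      by (rule surj_card_le[rotated]) (use finF in auto)
    also have "\<dots> = card ?F * card ?F" by (rule card_cartesian_product)
    also have "real (card ?F * card ?F) \<le> 2 powr (\<eta> / 2 * ?n\<^sup>2) * 2 powr (\<eta> / 2 * ?n\<^sup>2)"
      using \<delta>(2)[of "V \<times> V"] V(1) unfolding sq of_nat_mult by (intro mult_mono) auto
    also have "\<dots> = 2 powr (\<eta> * ?n\<^sup>2)" by (simp flip: powr_add)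
    finally show ?thesis by simp
  qed
  then show ?thesis by blast
qed

section \<open>Shearer's inequality and contraction\<close>

lemma prod_powr_le_mean:
  fixes z :: "'i \<Rightarrow> real"
  assumes "finite J" "J \<noteq> {}" "\<And>j. j \<in> J \<Longrightarrow> 0 \<le> z j"
  shows "(\<Prod>j\<in>J. z j powr (1 / card J)) \<le> sum z J / card J"
  using arith_geom_mean[OF assms] by (simp add: prod_powr_distrib sum_divide_distrib)

text \<open>Superadditivity of the geometric mean (Mahler's inequality). After division by
  \<open>x j + y j\<close>, the arithmetic-geometric mean inequality bounds the two products by
  means that add up to 1.\<close>

lemma prod_powr_add_le:
  fixes x y :: "'i \<Rightarrow> real"
  assumes J: "finite J" "J \<noteq> {}" and xy: "\<And>j. j \<in> J \<Longrightarrow> 0 \<le> x j" "\<And>j. j \<in> J \<Longrightarrow> 0 \<le> y j"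
  shows "(\<Prod>j\<in>J. x j powr (1 / card J)) + (\<Prod>j\<in>J. y j powr (1 / card J)) \<le> (\<Prod>j\<in>J. (x j + y j) powr (1 / card J))"
proof (cases "\<exists>j\<in>J. x j + y j = 0")
  case True
  then obtain j where j: "j \<in> J" "x j + y j = 0" by blast
  then have "x j = 0" "y j = 0" using xy[OF j(1)] by linarith+
  then have "(\<Prod>j\<in>J. x j powr (1 / card J)) = 0" "(\<Prod>j\<in>J. y j powr (1 / card J)) = 0"
    using J j by (auto intro!: prod_zero)
  then show ?thesis by (simp add: prod_nonneg)
next
  case False
  have pos: "x j + y j > 0" if "j \<in> J" for j
    using False xy[OF that] that by force
  have k: "real (card J) > 0" using J by (simp add: card_gt_0_iff)
  let ?p = "1 / real (card J)"
  let ?P = "\<Prod>j\<in>J. (x j + y j) powr ?p"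
  have P: "?P \<ge> 0" by (simp add: prod_nonneg)
  have split: "(\<Prod>j\<in>J. w j powr ?p) = (\<Prod>j\<in>J. (w j / (x j + y j)) powr ?p) * ?P"
    if "\<And>j. j \<in> J \<Longrightarrow> 0 \<le> w j" for w
    unfolding prod.distrib[symmetric]
  proof (rule prod.cong)
    fix j assume "j \<in> J"
    then show "w j powr ?p = (w j / (x j + y j)) powr ?p * (x j + y j) powr ?p"
      using pos[of j] that[of j] by (simp flip: powr_mult)
  qed simp
  have "(\<Prod>j\<in>J. x j powr ?p) + (\<Prod>j\<in>J. y j powr ?p)
      = ((\<Prod>j\<in>J. (x j / (x j + y j)) powr ?p) + (\<Prod>j\<in>J. (y j / (x j + y j)) powr ?p)) * ?P"
    using split[of x] split[of y] xy by (simp add: distrib_right)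
  also have "\<dots> \<le> ((\<Sum>j\<in>J. x j / (x j + y j)) / card J + (\<Sum>j\<in>J. y j / (x j + y j)) / card J) * ?P"
    using P xy J pos by (intro mult_right_mono add_mono prod_powr_le_mean) (auto intro!: divide_nonneg_pos)
  also have "(\<Sum>j\<in>J. x j / (x j + y j)) / card J + (\<Sum>j\<in>J. y j / (x j + y j)) / card J
      = (\<Sum>j\<in>J. (x j + y j) / (x j + y j)) / card J"
    by (simp only: add_divide_distrib sum.distrib)
  also have "(\<Sum>j\<in>J. (x j + y j) / (x j + y j)) = (\<Sum>j\<in>J. 1)"
    by (rule sum.cong) (use pos in force)+
  finally show ?thesis using k by simp
qed

text \<open>Deleting the point \<open>u\<close> splits \<open>F\<close> in two;
  a trace on a set containing \<open>u\<close> splits accordingly, and a trace on any other set does not grow.\<close>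
lemma shearer:
  assumes "finite U" "finite I" "k > 0"
    and "\<And>u. u \<in> U \<Longrightarrow> card {i \<in> I. u \<in> A i} = k"
    and "F \<subseteq> Pow U"
  shows "real (card F) \<le> (\<Prod>i\<in>I. real (card ((\<lambda>X. X \<inter> A i) ` F)) powr (1 / k))"
  using assms(1,4,5)
proof (induction U arbitrary: F)
  case empty
  then consider "F = {}" | "F = {{}}" by (auto simp: subset_singleton_iff)
  then show ?case by cases (simp_all add: prod_nonneg)
next
  case (insert u U)
  define F0 where "F0 = {X \<in> F. u \<notin> X}"
  define F1 where "F1 = (\<lambda>X. X - {u}) ` {X \<in> F. u \<in> X}"
  define tr where "tr G i = (\<lambda>X. X \<inter> A i) ` G" for G i
  have finF: "finite F" using insert.prems(2) insert.hyps(1) by (auto intro: finite_subset)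
  then have fintr: "finite (tr G i)" if "G \<subseteq> F" for G i
    using that by (auto simp: tr_def intro: finite_subset)
  have fin01: "finite F0" "finite F1" using finF by (auto simp: F0_def F1_def)
  have sub: "F0 \<subseteq> Pow U" "F1 \<subseteq> Pow U" using insert.prems(2) by (auto simp: F0_def F1_def)
  have "card F1 = card {X \<in> F. u \<in> X}"
    unfolding F1_def by (rule card_image) (auto simp: inj_on_def)
  moreover have "card F = card F0 + card {X \<in> F. u \<in> X}"
    unfolding F0_def using finF by (subst card_Un_disjoint[symmetric]) (auto intro: arg_cong[where f = card])
  ultimately have cF: "real (card F) = real (card F0) + real (card F1)" by simp
  let ?p = "1 / real k"
  have IH: "real (card G) \<le> (\<Prod>i\<in>I. real (card (tr G i)) powr ?p)" if "G \<subseteq> Pow U" for G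
    using insert.IH[OF _ that] insert.prems(1) by (simp add: tr_def)
  \<comment> \<open>\<open>J\<close> has exactly \<open>k\<close> members, so the exponent
    \<open>1 / k\<close> forms a geometric mean over \<open>J\<close> and
    \<open>prod_powr_add_le\<close> applies.\<close>
  define J where "J = {i \<in> I. u \<in> A i}"
  have cJ: "card J = k" using insert.prems(1) by (simp add: J_def)
  have J: "finite J" "J \<noteq> {}" "J \<subseteq> I" using assms(2,3) cJ by (auto simp: J_def simp del: Collect_empty_eq)
  have split: "(\<Prod>i\<in>I. f i) = (\<Prod>i\<in>I - J. f i) * (\<Prod>i\<in>J. f i)" for f :: "_ \<Rightarrow> real"
    by (rule prod.subset_diff[OF J(3) assms(2)])
  have out: "card (tr F0 i) \<le> card (tr F i)" "card (tr F1 i) \<le> card (tr F i)" if "i \<in> I - J" for i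
  proof -
    have u: "u \<notin> A i" using that by (auto simp: J_def)
    show "card (tr F0 i) \<le> card (tr F i)" using fintr[of F i]
      by (intro card_mono) (auto simp: tr_def F0_def)
    have "(X - {u}) \<inter> A i = X \<inter> A i" for X using u by auto
    then have "tr F1 i \<subseteq> tr F i" by (auto simp: tr_def F1_def)
    then show "card (tr F1 i) \<le> card (tr F i)" using fintr[of F i] by (intro card_mono) auto
  qed
  have "in": "card (tr F0 i) + card (tr F1 i) \<le> card (tr F i)" if "i \<in> J" for i
  proof -
    have u: "u \<in> A i" using that by (auto simp: J_def)
    have "card (tr F1 i) = card (insert u ` tr F1 i)"
      by (rule card_image[symmetric]) (auto simp: inj_on_def tr_def F1_def)
    moreover have "card (tr F0 i) + card (insert u ` tr F1 i) = card (tr F0 i \<union> insert u ` tr F1 i)"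
      using fin01 by (intro card_Un_disjoint[symmetric]) (auto simp: tr_def F0_def)
    moreover have "insert u ((X - {u}) \<inter> A i) = X \<inter> A i" if "u \<in> X" for X using u that by auto
    then have "tr F0 i \<union> insert u ` tr F1 i \<subseteq> tr F i" by (auto simp: tr_def F0_def F1_def)
    then have "card (tr F0 i \<union> insert u ` tr F1 i) \<le> card (tr F i)" using fintr[of F i] by (intro card_mono) auto
    ultimately show ?thesis by linarith
  qed
  let ?t = "\<lambda>G i. real (card (tr G i))"
  have "real (card F) \<le> (\<Prod>i\<in>I. ?t F0 i powr ?p) + (\<Prod>i\<in>I. ?t F1 i powr ?p)"
    unfolding cF using IH sub by (intro add_mono) auto
  also have "\<dots> \<le> (\<Prod>i\<in>I - J. ?t F i powr ?p) * (\<Prod>i\<in>J. ?t F0 i powr ?p)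
      + (\<Prod>i\<in>I - J. ?t F i powr ?p) * (\<Prod>i\<in>J. ?t F1 i powr ?p)"
    unfolding split using out
    by (intro add_mono mult_right_mono prod_mono) (auto intro!: powr_mono2 prod_nonneg)
  also have "\<dots> = (\<Prod>i\<in>I - J. ?t F i powr ?p) * ((\<Prod>i\<in>J. ?t F0 i powr ?p) + (\<Prod>i\<in>J. ?t F1 i powr ?p))"
    by (simp add: distrib_left)
  also have "\<dots> \<le> (\<Prod>i\<in>I - J. ?t F i powr ?p) * (\<Prod>i\<in>J. (?t F0 i + ?t F1 i) powr ?p)"
    using prod_powr_add_le[OF J(1,2), of "?t F0" "?t F1"]
    by (intro mult_left_mono) (auto simp: cJ prod_nonneg)
  also have "\<dots> \<le> (\<Prod>i\<in>I - J. ?t F i powr ?p) * (\<Prod>i\<in>J. ?t F i powr ?p)"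
  proof (intro mult_left_mono prod_mono conjI powr_mono2)
    fix i assume "i \<in> J"
    then show "?t F0 i + ?t F1 i \<le> ?t F i" using "in" by (metis of_nat_add of_nat_le_iff)
  qed (auto simp: prod_nonneg)
  also have "\<dots> = (\<Prod>i\<in>I. ?t F i powr ?p)" by (rule split[symmetric])
  finally show ?case by (simp add: tr_def)
qed

text \<open>Shearer's inequality on the ground set of all \<open>r\<close>-subsets of
  \<open>E\<close>, covered by the families of \<open>r\<close>-sets containing a given
  \<open>t\<close>-set. There are \<open>card E choose t\<close> such families, and each
  \<open>r\<close>-set lies in \<open>r choose t\<close> of them.\<close>

lemma shearer_layer:
  fixes E :: "'a set" and F :: "'a set set set" and c :: real
  assumes E: "finite E" and t: "t \<le> r" and cpos: "c > 0"
    and F: "\<And>B X. B \<in> F \<Longrightarrow> X \<in> B \<Longrightarrow> X \<subseteq> E \<and> card X = r"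
    and c: "\<And>T. T \<subseteq> E \<Longrightarrow> card T = t \<Longrightarrow> card ((\<lambda>B. {X \<in> B. T \<subseteq> X}) ` F) \<le> c"
  shows "real (card F) \<le> c powr (real (card E choose t) / real (r choose t))"
proof -
  define U where "U = {X. X \<subseteq> E \<and> card X = r}"
  define I where "I = {T. T \<subseteq> E \<and> card T = t}"
  let ?A = "\<lambda>T. {X. T \<subseteq> X}"
  have fin: "finite U" "finite I" using E by (auto simp: U_def I_def)
  have k: "r choose t > 0" using t by simp
  have cov: "card {T \<in> I. X \<in> ?A T} = r choose t" if "X \<in> U" for X
  proof -
    have X: "X \<subseteq> E" "card X = r" "finite X" using that E by (auto simp: U_def intro: finite_subset)
    then have "{T \<in> I. X \<in> ?A T} = {T. T \<subseteq> X \<and> card T = t}" by (auto simp: I_def)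
    then show ?thesis using n_subsets[OF X(3)] X(2) by simp
  qed
  have FU: "F \<subseteq> Pow U" unfolding U_def using F by blast
  have "real (card F) \<le> (\<Prod>T\<in>I. real (card ((\<lambda>B. B \<inter> ?A T) ` F)) powr (1 / (r choose t)))"
    by (rule shearer[OF fin k cov FU])
  also have "\<dots> \<le> (\<Prod>T\<in>I. c powr (1 / (r choose t)))"
  proof (intro prod_mono conjI powr_mono2)
    fix T assume "T \<in> I"
    then show "real (card ((\<lambda>B. B \<inter> ?A T) ` F)) \<le> c"
      using c[of T] by (simp add: I_def Int_def)
  qed auto
  also have "\<dots> = (c powr (1 / (r choose t))) ^ card I" by simp
  also have "card I = card E choose t" unfolding I_def by (rule n_subsets[OF E])
  also have "(c powr (1 / (r choose t))) ^ (card E choose t) = c powr (real (card E choose t) / real (r choose t))"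
    using cpos by (simp add: powr_power)
  finally show ?thesis .
qed

section \<open>Minors by contraction, and the traces of basis families\<close>

lemma matroid_iso_image:
  assumes g: "inj_on g A" and iff: "\<And>Y. Y \<subseteq> A \<Longrightarrow> g ` Y \<in> Ind \<longleftrightarrow> Y \<in> W"
  shows "matroid_iso (g ` A) Ind A W"
  unfolding matroid_iso_def
proof (intro exI conjI allI impI)
  show "bij_betw (inv_into A g) (g ` A) A"
    using g by (simp add: bij_betw_inv_into inj_on_imp_bij_betw)
  fix X assume X: "X \<subseteq> g ` A"
  have "inv_into A g ` X \<subseteq> A" using X by (auto intro: inv_into_into)
  moreover have "g ` inv_into A g ` X = X" using X by (rule image_inv_into_cancel[OF refl])
  ultimately show "X \<in> Ind \<longleftrightarrow> inv_into A g ` X \<in> W" using iff[of "inv_into A g ` X"] by simp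
qed

text \<open>An independent \<open>T\<close> is its own only basis, so the choice of \<open>J\<close>
  in \<open>minor_indep\<close> disappears.\<close>

lemma minor_indep_contract_indep:
  assumes M: "matroid E Ind" and T: "T \<in> Ind" and G: "G \<subseteq> E - T"
  shows "minor_indep E Ind T (E - T - G) = {X. X \<subseteq> G \<and> X \<union> T \<in> Ind}"
proof -
  have J: "J = T" if J: "J \<subseteq> T" "\<forall>y\<in>T - J. insert y J \<notin> Ind" for J
  proof (rule ccontr)
    assume "J \<noteq> T"
    then obtain y where y: "y \<in> T - J" using J(1) by auto
    then have "insert y J \<subseteq> T" using J(1) by auto
    then show False using matroid_subset[OF M T] J(2) y by blast
  qed
  have E: "E - T - (E - T - G) = G" using G by auto
  show ?thesis
  proof (intro equalityI subsetI)
    fix X assume "X \<in> minor_indep E Ind T (E - T - G)"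
    then show "X \<in> {X. X \<subseteq> G \<and> X \<union> T \<in> Ind}" unfolding minor_indep_def E using J by auto
  next
    fix X assume "X \<in> {X. X \<subseteq> G \<and> X \<union> T \<in> Ind}"
    then show "X \<in> minor_indep E Ind T (E - T - G)" unfolding minor_indep_def E
      using T by (auto intro!: exI[of _ T])
  qed
qed

definition hexagon_minor_free :: "'a set \<Rightarrow> 'a set set \<Rightarrow> bool" where
  "hexagon_minor_free E Ind \<longleftrightarrow> \<not> has_minor_iso E Ind {1..6::nat} whirl3 \<and> \<not> has_minor_iso E Ind {1..6::nat} MK4"

definition has_rank :: "'a set set \<Rightarrow> nat \<Rightarrow> bool" where
  "has_rank Ind r \<longleftrightarrow> (\<forall>X\<in>Ind. card X \<le> r) \<and> (\<exists>X\<in>Ind. card X = r)"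

lemma matroid_contract:
  assumes M: "matroid E Ind" and T: "T \<in> Ind"
  shows "matroid (E - T) {X. X \<subseteq> E - T \<and> X \<union> T \<in> Ind}"
proof -
  have fin: "finite X" if "X \<subseteq> E" for X using that matroid_finite[OF M] by (rule finite_subset)
  have TE: "T \<subseteq> E" by (rule matroid_carrier[OF M T])
  have ex: "\<exists>y\<in>Y - X. insert y X \<subseteq> E - T \<and> insert y X \<union> T \<in> Ind"
    if X: "X \<subseteq> E - T" "X \<union> T \<in> Ind" and Y: "Y \<subseteq> E - T" "Y \<union> T \<in> Ind" and c: "card X < card Y" for X Y
  proof -
    have "finite X" "finite Y" "finite T" using fin[of X] fin[of Y] fin[OF TE] X(1) Y(1) by auto
    then have "card (X \<union> T) = card X + card T" "card (Y \<union> T) = card Y + card T"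
      using X(1) Y(1) by (auto intro!: card_Un_disjoint)
    then obtain y where y: "y \<in> (Y \<union> T) - (X \<union> T)" "insert y (X \<union> T) \<in> Ind"
      using matroid_exchange[OF M X(2) Y(2)] c by auto
    then show ?thesis using X Y by (intro bexI[of _ y]) auto
  qed
  have "Y \<union> T \<in> Ind" if "X \<union> T \<in> Ind" "Y \<subseteq> X" for X Y
    using matroid_subset[OF M that(1), of "Y \<union> T"] that(2) by auto
  then show ?thesis unfolding matroid_def using T matroid_finite[OF M] ex by auto
qed

text \<open>The rank makes every independent set of the contraction have at most three elements, as
  \<open>whirl3\<close> and \<open>MK4\<close> require. Deleting all but the six points leaves a
  minor in which only the image of \<open>{2, 4, 6}\<close> is open, and its status selects the
  isomorphism type.\<close>

lemma hexagon_free_matroid_contract: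
  assumes M: "matroid E Ind" and rk: "has_rank Ind r" and free: "hexagon_minor_free E Ind"
    and T: "T \<in> Ind" "card T = r - 3" "r \<ge> 3"
  shows "hexagon_free_matroid (E - T) {X. X \<subseteq> E - T \<and> X \<union> T \<in> Ind}"
proof
  let ?I = "{X. X \<subseteq> E - T \<and> X \<union> T \<in> Ind}"
  show "matroid (E - T) ?I" by (rule matroid_contract[OF M T(1)])
  have TE: "T \<subseteq> E" by (rule matroid_carrier[OF M T(1)])
  have r3: "card X \<le> 3" if "X \<in> ?I" for X
  proof -
    have "finite X" "finite T" using that TE matroid_finite[OF M] by (auto intro: finite_subset)
    then have "card (X \<union> T) = card X + card T" using that by (intro card_Un_disjoint) auto
    moreover have "card (X \<union> T) \<le> r" using that rk by (simp add: has_rank_def)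
    ultimately show ?thesis using T by linarith
  qed
  show False if g: "inj_on g {1..6::nat}" "g ` {1..6} \<subseteq> E - T"
    and ind: "\<And>X. \<lbrakk>X \<subseteq> {1..6}; card X \<le> 3; X \<notin> hexagon_lines\<rbrakk> \<Longrightarrow> g ` X \<in> ?I"
    and dep: "g ` {1,2,3} \<notin> ?I" "g ` {3,4,5} \<notin> ?I" "g ` {5,6,1} \<notin> ?I" for g
  proof -
    let ?G = "g ` {1..6}"
    have mi: "minor_indep E Ind T (E - T - ?G) = {X. X \<subseteq> ?G \<and> X \<union> T \<in> Ind}"
      by (rule minor_indep_contract_indep[OF M T(1) g(2)])
    have E: "E - T - (E - T - ?G) = ?G" using g(2) by auto
    have inI: "g ` Y \<in> {X. X \<subseteq> ?G \<and> X \<union> T \<in> Ind} \<longleftrightarrow> g ` Y \<in> ?I" if "Y \<subseteq> {1..6}" for Y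
      using image_mono[OF that, of g] g(2) by auto
    have c3: "card Y \<le> 3" if "Y \<subseteq> {1..6}" "g ` Y \<in> ?I" for Y
    proof -
      have "inj_on g Y" using g(1) that(1) by (rule inj_on_subset)
      then show ?thesis using r3[OF that(2)] by (simp add: card_image)
    qed
    have TE': "E - T - ?G \<subseteq> E" "T \<inter> (E - T - ?G) = {}" by auto
    show False
    proof (cases "g ` {2,4,6} \<in> ?I")
      case True
      have iff: "g ` Y \<in> ?I \<longleftrightarrow> Y \<in> whirl3" if Y: "Y \<subseteq> {1..6}" for Y
      proof
        assume h: "g ` Y \<in> ?I"
        have ne: "Y \<noteq> Z" if "g ` Z \<notin> ?I" for Z using h that by metis
        have "Y \<notin> {{1,2,3},{3,4,5},{5,6,1}}" using ne[OF dep(1)] ne[OF dep(2)] ne[OF dep(3)] by blast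
        then show "Y \<in> whirl3" using c3[OF Y h] Y by (simp add: whirl3_def)
      next
        assume h: "Y \<in> whirl3"
        then have "Y \<notin> hexagon_lines \<or> Y = {2,4,6}" by (auto simp: whirl3_def hexagon_lines_def)
        then show "g ` Y \<in> ?I" using ind[OF Y] True h by (auto simp only: whirl3_def mem_Collect_eq)
      qed
      have "matroid_iso ?G {X. X \<subseteq> ?G \<and> X \<union> T \<in> Ind} {1..6} whirl3"
        by (rule matroid_iso_image[OF g(1)]) (use iff inI in blast)
      then have "has_minor_iso E Ind {1..6::nat} whirl3"
        unfolding has_minor_iso_def using TE TE' mi E by (intro exI[of _ T] exI[of _ "E - T - ?G"]) simp
      then show False using free by (simp add: hexagon_minor_free_def)
    next
      case False
      have iff: "g ` Y \<in> ?I \<longleftrightarrow> Y \<in> MK4" if Y: "Y \<subseteq> {1..6}" for Y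
      proof
        assume h: "g ` Y \<in> ?I"
        have ne: "Y \<noteq> Z" if "g ` Z \<notin> ?I" for Z using h that by metis
        have "Y \<notin> {{1,2,3},{3,4,5},{5,6,1},{2,4,6}}"
          using ne[OF dep(1)] ne[OF dep(2)] ne[OF dep(3)] ne[OF False] by blast
        then show "Y \<in> MK4" using c3[OF Y h] Y by (simp add: MK4_def)
      next
        assume h: "Y \<in> MK4"
        then show "g ` Y \<in> ?I" using ind[OF Y] by (simp add: MK4_def hexagon_lines_def)
      qed
      have "matroid_iso ?G {X. X \<subseteq> ?G \<and> X \<union> T \<in> Ind} {1..6} MK4"
        by (rule matroid_iso_image[OF g(1)]) (use iff inI in blast)
      then have "has_minor_iso E Ind {1..6::nat} MK4"
        unfolding has_minor_iso_def using TE TE' mi E by (intro exI[of _ T] exI[of _ "E - T - ?G"]) simp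
      then show False using free by (simp add: hexagon_minor_free_def)
    qed
  qed
qed

text \<open>Stands in for the contraction when \<open>T\<close> is dependent: it has no independent
  triple, matching an empty trace.\<close>

lemma hexagon_free_matroid_trivial:
  assumes "finite V"
  shows "hexagon_free_matroid V {{}}"
proof
  show "matroid V {{}}" using assms by (auto simp: matroid_def)
  show False if "\<And>X. \<lbrakk>X \<subseteq> {1..6}; card X \<le> 3; X \<notin> hexagon_lines\<rbrakk> \<Longrightarrow> g ` X \<in> {{}}" for g :: "nat \<Rightarrow> 'a"
    using that[of "{1}"] by (auto simp: hexagon_lines_def)
qed

definition bases :: "'a set set \<Rightarrow> nat \<Rightarrow> 'a set set" where
  "bases Ind r = {X \<in> Ind. card X = r}"

lemma indep_iff_subset_basis:
  assumes M: "matroid E Ind" and rk: "has_rank Ind r"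
  shows "X \<in> Ind \<longleftrightarrow> (\<exists>B \<in> bases Ind r. X \<subseteq> B)"
proof
  assume X: "X \<in> Ind"
  obtain Y where Y: "Y \<in> Ind" "card Y = r" using rk by (auto simp: has_rank_def)
  have "card X \<le> card Y" using rk X Y(2) by (simp add: has_rank_def)
  then show "\<exists>B \<in> bases Ind r. X \<subseteq> B"
    using matroid_augment[OF M X Y(1)] Y(2) by (auto simp: bases_def)
next
  assume "\<exists>B \<in> bases Ind r. X \<subseteq> B"
  then show "X \<in> Ind" using matroid_subset[OF M] by (auto simp: bases_def)
qed

definition minor_free_matroids :: "'a set \<Rightarrow> nat \<Rightarrow> 'a set set set" where
  "minor_free_matroids E r = {Ind. matroid E Ind \<and> has_rank Ind r \<and> hexagon_minor_free E Ind}"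

lemma inj_on_bases: "inj_on (\<lambda>Ind. bases Ind r) {Ind. matroid E Ind \<and> has_rank Ind r}"
proof (rule inj_onI)
  fix I J assume IJ: "I \<in> {Ind. matroid E Ind \<and> has_rank Ind r}" "J \<in> {Ind. matroid E Ind \<and> has_rank Ind r}"
    "bases I r = bases J r"
  then have "X \<in> I \<longleftrightarrow> X \<in> J" for X
    using indep_iff_subset_basis[of E I r X] indep_iff_subset_basis[of E J r X] by simp
  then show "I = J" by blast
qed

text \<open>Meant for ranks near 0 or near the size of \<open>E\<close>, where the number of
  \<open>r\<close>-sets is already small enough.\<close>

lemma card_minor_free_matroids_trivial:
  assumes E: "finite E"
  shows "card (minor_free_matroids E r) \<le> 2 ^ (card E choose r)"
proof -
  have "card (minor_free_matroids E r) = card ((\<lambda>Ind. bases Ind r) ` minor_free_matroids E r)"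
    by (rule card_image[symmetric], rule inj_on_subset[OF inj_on_bases[of r E]])
      (auto simp: minor_free_matroids_def)
  also have "\<dots> \<le> card (Pow {X. X \<subseteq> E \<and> card X = r})"
  proof (rule card_mono)
    show "(\<lambda>Ind. bases Ind r) ` minor_free_matroids E r \<subseteq> Pow {X. X \<subseteq> E \<and> card X = r}"
      using matroid_carrier by (fastforce simp: minor_free_matroids_def bases_def)
  qed (use E in simp)
  also have "\<dots> = 2 ^ (card E choose r)" using E by (simp add: card_Pow n_subsets)
  finally show ?thesis .
qed

text \<open>For an \<open>(r - 3)\<close>-set \<open>T\<close>, the bases containing
  \<open>T\<close> are the sets \<open>X \<union> T\<close> with \<open>X\<close> an independent
  triple of the contraction by \<open>T\<close>. Hence there are no more traces at \<open>T\<close>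
  than families counted by \<open>c\<close>.\<close>

lemma card_minor_free_matroids:
  fixes E :: "'a set" and c :: real
  assumes E: "finite E" and r: "3 \<le> r" "r \<le> card E" and cpos: "c > 0"
    and c: "\<And>V :: 'a set. finite V \<Longrightarrow> card V = card E - (r - 3) \<Longrightarrow>
      card {{X \<in> Ind. card X = 3} | Ind. hexagon_free_matroid V Ind} \<le> c"
  shows "card (minor_free_matroids E r) \<le> c powr (real (card E choose (r - 3)) / real (r choose (r - 3)))"
proof -
  let ?F = "(\<lambda>Ind. bases Ind r) ` minor_free_matroids E r"
  have "card (minor_free_matroids E r) = card ?F"
    by (rule card_image[symmetric], rule inj_on_subset[OF inj_on_bases[of r E]])
      (auto simp: minor_free_matroids_def)
  also have "real (card ?F) \<le> c powr (real (card E choose (r - 3)) / real (r choose (r - 3)))"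
  proof (rule shearer_layer[OF E])
    show "X \<subseteq> E \<and> card X = r" if "B \<in> ?F" "X \<in> B" for B X
      using that matroid_carrier by (fastforce simp: minor_free_matroids_def bases_def)
    fix T assume T: "T \<subseteq> E" "card T = r - 3"
    have finT: "finite T" using T(1) E by (rule finite_subset)
    let ?H = "{{X \<in> Ind. card X = 3} | Ind. hexagon_free_matroid (E - T) Ind}"
    have "?H \<subseteq> Pow (Pow (E - T))" using matroid_carrier hexagon_free_matroid.mat by fastforce
    then have finH: "finite ?H" by (rule finite_subset) (use E in simp)
    have "(\<lambda>B. {X \<in> B. T \<subseteq> X}) ` ?F \<subseteq> (\<lambda>C. (\<lambda>X. X \<union> T) ` C) ` ?H"
    proof (intro subsetI, elim imageE)
      fix C B Ind assume C: "C = {X \<in> B. T \<subseteq> X}" "B = bases Ind r" and Ind: "Ind \<in> minor_free_matroids E r"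
      then have M: "matroid E Ind" "has_rank Ind r" "hexagon_minor_free E Ind" by (auto simp: minor_free_matroids_def)
      show "C \<in> (\<lambda>C. (\<lambda>X. X \<union> T) ` C) ` ?H"
      proof (cases "T \<in> Ind")
        case True
        let ?I = "{X. X \<subseteq> E - T \<and> X \<union> T \<in> Ind}"
        have "hexagon_free_matroid (E - T) ?I"
          by (rule hexagon_free_matroid_contract[OF M True T(2) r(1)])
        moreover have "C = (\<lambda>X. X \<union> T) ` {X \<in> ?I. card X = 3}"
        proof (intro equalityI subsetI)
          fix X assume X: "X \<in> C"
          then have "X \<in> Ind" "card X = r" "T \<subseteq> X" by (auto simp: C bases_def)
          moreover from this have "X \<subseteq> E" using matroid_carrier[OF M(1)] by blast
          moreover have "card (X - T) = 3" using calculation finT T(2) r(1) by (simp add: card_Diff_subset)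
          moreover have "X - T \<union> T = X" using calculation(3) by auto
          ultimately show "X \<in> (\<lambda>X. X \<union> T) ` {X \<in> ?I. card X = 3}"
            by (intro rev_image_eqI[of "X - T"]) auto
        next
          fix X assume "X \<in> (\<lambda>X. X \<union> T) ` {X \<in> ?I. card X = 3}"
          then obtain Y where Y: "X = Y \<union> T" "Y \<subseteq> E - T" "Y \<union> T \<in> Ind" "card Y = 3" by auto
          then have "finite Y" using E by (auto intro: finite_subset)
          then have "card X = card Y + card T" unfolding Y(1) using finT Y(2) by (intro card_Un_disjoint) auto
          then show "X \<in> C" using Y T(2) r(1) by (simp add: C bases_def)
        qed
        ultimately show ?thesis by blast
      next
        case False
        then have "C = (\<lambda>X. X \<union> T) ` {X \<in> {{}}. card X = 3}"
          using matroid_subset[OF M(1)] by (auto simp: C bases_def)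
        moreover have "hexagon_free_matroid (E - T) {{}}"
          by (rule hexagon_free_matroid_trivial) (use E in simp)
        ultimately show ?thesis by blast
      qed
    qed
    then have "card ((\<lambda>B. {X \<in> B. T \<subseteq> X}) ` ?F) \<le> card ?H"
      by (rule surj_card_le[OF finH])
    moreover have "card ?H \<le> c"
      by (rule c) (use E T finT in \<open>auto simp: card_Diff_subset\<close>)
    ultimately show "real (card ((\<lambda>B. {X \<in> B. T \<subseteq> X}) ` ?F)) \<le> c" by linarith
  qed (use cpos in simp_all)
  finally show ?thesis .
qed

section \<open>Counting\<close>

lemma finite_matroids: "finite E \<Longrightarrow> finite {Ind. matroid E Ind \<and> P Ind}"
  by (rule finite_subset[of _ "Pow (Pow E)"]) (auto dest: matroid_carrier)

text \<open>Suppose every enlargement of \<open>X\<close> by an element of \<open>Y\<close> fell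
  into \<open>S\<close>. Two different ones would be members of \<open>S\<close> meeting in
  \<open>X\<close>, which has size \<open>r - 1\<close>; if there is only one, it equals
  \<open>Y\<close>, which is not in \<open>S\<close>.\<close>

lemma sparse_paving_matroid:
  assumes E: "finite E" and r: "r \<ge> 1"
    and far: "\<And>X Y. X \<in> S \<Longrightarrow> Y \<in> S \<Longrightarrow> X \<noteq> Y \<Longrightarrow> card (X \<inter> Y) \<noteq> r - 1"
    and S: "\<And>X. X \<in> S \<Longrightarrow> X \<subseteq> E \<and> card X = r"
  shows "matroid E {X. X \<subseteq> E \<and> card X \<le> r \<and> X \<notin> S}" (is "matroid E ?I")
  unfolding matroid_def
proof (intro conjI allI impI ballI)
  show "finite E" by (rule E)
  show "{} \<in> ?I" using r S[of "{}"] by auto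
  fix X assume X: "X \<in> ?I"
  then show "X \<subseteq> E" by simp
next
  fix X Y assume XY: "X \<in> ?I \<and> Y \<subseteq> X"
  then have "finite X" using E by (auto intro: finite_subset)
  then have "card Y \<le> card X" using XY by (auto intro: card_mono)
  moreover have "Y \<notin> S"
  proof
    assume "Y \<in> S"
    then have "card X \<le> card Y" using S[of Y] XY by auto
    then have "Y = X" using XY \<open>finite X\<close> by (intro card_seteq) auto
    then show False using XY \<open>Y \<in> S\<close> by simp
  qed
  ultimately show "Y \<in> ?I" using XY by auto
next
  fix X Y assume XY: "X \<in> ?I \<and> Y \<in> ?I \<and> card X < card Y"
  then have fin: "finite X" "finite Y" using E by (auto intro: finite_subset)
  have "\<not> Y \<subseteq> X" using XY card_mono[OF fin(1), of Y] by auto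
  then obtain y where y: "y \<in> Y - X" by blast
  have c: "card (insert z X) = Suc (card X)" if "z \<in> Y - X" for z using that fin by simp
  have "\<exists>z\<in>Y - X. insert z X \<notin> S"
  proof (rule ccontr)
    assume "\<not> ?thesis"
    then have all: "insert z X \<in> S" if "z \<in> Y - X" for z using that by blast
    have cX: "Suc (card X) = r" using all[OF y] S c[OF y] by metis
    have "Y - X = {y}"
    proof (rule ccontr)
      assume "Y - X \<noteq> {y}"
      then obtain z where z: "z \<in> Y - X" "z \<noteq> y" using y by blast
      have "insert y X \<inter> insert z X = X" using y z by auto
      moreover have "insert y X \<noteq> insert z X" using y z by auto
      ultimately show False using far[OF all[OF y] all[OF z(1)]] cX by auto
    qed
    then have "Y \<subseteq> insert y X" by auto
    moreover have "card (insert y X) \<le> card Y" using XY c[OF y] by simp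
    ultimately have "Y = insert y X" using fin by (intro card_seteq) auto
    then show False using all[OF y] XY by simp
  qed
  then obtain z where z: "z \<in> Y - X" "insert z X \<notin> S" by blast
  have "card (insert z X) \<le> r" using c[OF z(1)] XY by simp
  then show "\<exists>y\<in>Y - X. insert y X \<in> ?I" using z XY by (intro bexI[of _ z]) auto
qed

text \<open>Graham and Sloane's code: the \<open>r\<close>-subsets whose sum lies in a fixed residue class modulo \<open>n\<close>.\<close>
lemma graham_sloane:
  assumes n: "n \<ge> 1" and r: "r \<ge> 1"
  shows "\<exists>C. (\<forall>X\<in>C. X \<subseteq> {1..n} \<and> card X = r) \<and> (\<forall>X\<in>C. \<forall>Y\<in>C. X \<noteq> Y \<longrightarrow> card (X \<inter> Y) \<noteq> r - 1)
    \<and> n choose r \<le> n * card C"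
proof -
  define U where "U = {X. X \<subseteq> {1..n} \<and> card X = r}"
  define C where "C j = {X \<in> U. \<Sum>X mod n = j}" for j
  have finU: "finite U" by (simp add: U_def)
  have cU: "card U = n choose r" unfolding U_def using n_subsets[of "{1..n}" r] by simp
  have "(\<Sum>j<n. card (C j)) = n choose r"
  proof -
    have "(\<Sum>j\<in>{..<n}. \<Sum>X | X \<in> U \<and> \<Sum>X mod n = j. 1) = (\<Sum>X\<in>U. 1 :: nat)"
      by (rule sum.group[OF finU]) (use n in auto)
    then show ?thesis by (simp add: C_def cU)
  qed
  have "\<exists>j<n. n choose r \<le> n * card (C j)"
  proof (rule ccontr)
    assume "\<not> ?thesis"
    then have "(\<Sum>j<n. n * card (C j)) < (\<Sum>j<n. n choose r)"
      using n by (intro sum_strict_mono) (auto simp: not_le lessThan_empty_iff)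
    then show False using \<open>(\<Sum>j<n. card (C j)) = n choose r\<close> by (simp flip: sum_distrib_left)
  qed
  then obtain j where j: "n choose r \<le> n * card (C j)" by blast
  \<comment> \<open>Sets meeting in \<open>r - 1\<close> elements differ by exchanging one
    \<open>x\<close> for one \<open>y\<close>. Equal residues of the sums make \<open>x\<close> and
    \<open>y\<close> congruent modulo \<open>n\<close>, hence equal in
    \<open>{1..n}\<close>.\<close>
  have "card (X \<inter> Y) \<noteq> r - 1" if X: "X \<in> C j" and Y: "Y \<in> C j" and ne: "X \<noteq> Y" for X Y
  proof
    assume c: "card (X \<inter> Y) = r - 1"
    have fin: "finite X" "finite Y" using X Y by (auto simp: C_def U_def intro: finite_subset)
    have "card (X - Y) = 1" "card (Y - X) = 1"
      using X Y c r fin card_Diff_subset_Int[of X Y] card_Diff_subset_Int[of Y X]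
      by (auto simp: C_def U_def Int_commute)
    then obtain x y where xy: "X - Y = {x}" "Y - X = {y}" by (auto simp: card_1_singleton_iff)
    have sX: "\<Sum>X = x + \<Sum>(X \<inter> Y)"
      using sum.Int_Diff[OF fin(1), of "\<lambda>x. x" Y] xy by simp
    have sY: "\<Sum>Y = y + \<Sum>(X \<inter> Y)"
      using sum.Int_Diff[OF fin(2), of "\<lambda>x. x" X] xy by (simp add: Int_commute)
    have eq: "(x + \<Sum>(X \<inter> Y)) mod n = (y + \<Sum>(X \<inter> Y)) mod n"
      using X Y sX sY by (simp add: C_def)
    define s where "s = \<Sum>(X \<inter> Y)"
    \<comment> \<open>Subtraction on naturals truncates, so the case \<open>a < b\<close> is
      immediate; the fact is then used in both directions.\<close>
    have diff: "n dvd a - b" if "(a + s) mod n = (b + s) mod n" for a b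
    proof (cases "b \<le> a")
      case True
      then have "b + s \<le> a + s" by simp
      then have "n dvd (a + s) - (b + s)" using mod_eq_dvd_iff_nat[of "b + s" "a + s" n] that by blast
      then show ?thesis by simp
    qed simp
    note dvd = diff[OF eq[folded s_def]] diff[OF eq[folded s_def, symmetric]]
    have "x \<in> X" "y \<in> Y" using xy by blast+
    then have "x \<in> {1..n}" "y \<in> {1..n}" using X Y unfolding C_def U_def by blast+
    then have "x - y < n" "y - x < n" by auto
    then have "x - y = 0" "y - x = 0" using dvd by (auto dest: dvd_imp_le)
    then have "x = y" by simp
    then show False using xy by blast
  qed
  then show ?thesis using j by (intro exI[of _ "C j"]) (auto simp: C_def U_def)
qed

text \<open>Every subset of the code satisfies the same intersection condition, and different
  subsets give different matroids.\<close>

lemma num_matroids_lower: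
  assumes n: "n \<ge> 1" and r: "r \<ge> 1"
  shows "2 powr (real (n choose r) / n) \<le> num_matroids n"
proof -
  obtain C where C: "\<forall>X\<in>C. X \<subseteq> {1..n} \<and> card X = r"
    "\<forall>X\<in>C. \<forall>Y\<in>C. X \<noteq> Y \<longrightarrow> card (X \<inter> Y) \<noteq> r - 1" "n choose r \<le> n * card C"
    using graham_sloane[OF n r] by metis
  have finC: "finite C" using C(1) by (intro finite_subset[of C "Pow {1..n}"]) auto
  let ?f = "\<lambda>S. {X. X \<subseteq> {1..n} \<and> card X \<le> r \<and> X \<notin> S}"
  have "inj_on ?f (Pow C)"
  proof (rule inj_onI)
    fix S S' assume S: "S \<in> Pow C" "S' \<in> Pow C" "?f S = ?f S'"
    have "X \<in> S \<longleftrightarrow> X \<in> S'" if "X \<in> C" for X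
    proof -
      have "X \<in> ?f S \<longleftrightarrow> X \<in> ?f S'" by (simp only: S(3))
      then show ?thesis using C(1) that by auto
    qed
    then show "S = S'" using S(1,2) by blast
  qed
  moreover have "?f ` Pow C \<subseteq> {Ind. matroid {1..n} Ind}"
  proof (intro image_subsetI CollectI sparse_paving_matroid)
    fix S X Y assume "S \<in> Pow C" "X \<in> S" "Y \<in> S" "X \<noteq> Y"
    then show "card (X \<inter> Y) \<noteq> r - 1" using C(2) by blast
  qed (use r C(1) in auto)
  ultimately have "card (Pow C) \<le> num_matroids n"
    unfolding num_matroids_def using finite_matroids[of "{1..n}" "\<lambda>_. True"] by (intro card_inj_on_le) auto
  then have "2 ^ card C \<le> num_matroids n" by (simp add: card_Pow finC)
  then have "real (2 ^ card C) \<le> num_matroids n" by (simp only: of_nat_le_iff)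
  moreover have "real (n choose r) / n \<le> card C"
    using C(3) n by (simp add: divide_le_eq mult.commute flip: of_nat_mult)
  then have "2 powr (real (n choose r) / n) \<le> 2 powr card C" by simp
  then have "2 powr (real (n choose r) / n) \<le> real (2 ^ card C)" by (simp add: powr_realpow)
  ultimately show ?thesis by linarith
qed

lemma num_matroids_X_le:
  "num_matroids_X n \<le> (\<Sum>r\<le>n. card (minor_free_matroids {1..n} r))"
proof -
  have "{Ind. matroid {1..n} Ind \<and> hexagon_minor_free {1..n} Ind} \<subseteq> (\<Union>r\<le>n. minor_free_matroids {1..n} r)"
  proof
    fix Ind assume I: "Ind \<in> {Ind. matroid {1..n} Ind \<and> hexagon_minor_free {1..n} Ind}"
    then have M: "matroid {1..n} Ind" by simp
    have sub: "Ind \<subseteq> Pow {1..n}" using matroid_carrier[OF M] by auto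
    then have fin: "finite (card ` Ind)" by (intro finite_imageI finite_subset[of Ind]) auto
    have ne: "card ` Ind \<noteq> {}" using matroid_empty[OF M] by auto
    define r where "r = Max (card ` Ind)"
    have "r \<in> card ` Ind" unfolding r_def by (rule Max_in[OF fin ne])
    then have "has_rank Ind r" using Max_ge[OF fin] by (auto simp: has_rank_def r_def)
    moreover have "r \<le> n"
    proof -
      obtain X where "X \<in> Ind" "card X = r" using \<open>r \<in> card ` Ind\<close> by auto
      then show ?thesis using sub card_mono[of "{1..n}" X] by auto
    qed
    ultimately show "Ind \<in> (\<Union>r\<le>n. minor_free_matroids {1..n} r)"
      using I by (auto simp: minor_free_matroids_def)
  qed
  moreover have "finite (minor_free_matroids {1..n} r)" for r
    unfolding minor_free_matroids_def by (rule finite_matroids) simp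
  ultimately have "num_matroids_X n \<le> card (\<Union>r\<le>n. minor_free_matroids {1..n} r)"
    unfolding num_matroids_X_def hexagon_minor_free_def by (intro card_mono) auto
  also have "\<dots> \<le> (\<Sum>r\<le>n. card (minor_free_matroids {1..n} r))" by (rule card_UN_le) simp
  finally show ?thesis .
qed

section \<open>Comparing the exponents\<close>

lemma six_times_choose_three: "6 * ((k + 3) choose 3) = (k + 1) * (k + 2) * (k + 3)"
proof (induction k)
  case (Suc k)
  have two: "2 * ((k + 3) choose 2) = (k + 3) * (k + 2)"
    by (induction k) (simp_all add: eval_nat_numeral)
  have "(Suc k + 3) choose 3 = ((k + 3) choose 2) + ((k + 3) choose 3)" by (simp add: eval_nat_numeral)
  then have "6 * ((Suc k + 3) choose 3) = 3 * (2 * ((k + 3) choose 2)) + 6 * ((k + 3) choose 3)" by simp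
  then show ?case unfolding two Suc.IH by (simp add: algebra_simps)
qed simp

text \<open>With \<open>s = k + 3\<close>, this turns the quotient of the rank-3 exponent
  \<open>s\<^sup>2\<close> by \<open>s choose 3\<close> into at most \<open>24 / s\<close>.\<close>

lemma square_le_choose_three:
  assumes "k \<ge> 1"
  shows "(real (k + 3))\<^sup>2 * real (k + 3) \<le> 24 * real ((k + 3) choose 3)"
proof -
  have "(k + 3) * (k + 3) \<le> 4 * ((k + 1) * (k + 2))" using assms by (simp add: algebra_simps)
  then have "(k + 3) * (k + 3) * (k + 3) \<le> 4 * ((k + 1) * (k + 2)) * (k + 3)" by (rule mult_right_mono) simp
  also have "\<dots> = 4 * ((k + 1) * (k + 2) * (k + 3))" by (simp only: mult.assoc)
  also have "\<dots> = 24 * ((k + 3) choose 3)" unfolding six_times_choose_three[of k, symmetric] by simp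
  finally have "real ((k + 3) * (k + 3) * (k + 3)) \<le> real (24 * ((k + 3) choose 3))" by (simp only: of_nat_le_iff)
  then show ?thesis by (simp add: power2_eq_square)
qed

lemma central_binomial_ge: "2 ^ n \<le> (real n + 1) * real (n choose (n div 2))"
proof -
  have "(2::nat) ^ n = (\<Sum>k\<le>n. n choose k)" by (rule choose_row_sum[symmetric])
  also have "\<dots> \<le> (\<Sum>k\<le>n. n choose (n div 2))" by (intro sum_mono binomial_maximum)
  also have "\<dots> = (n + 1) * (n choose (n div 2))" by simp
  finally have "real (2 ^ n) \<le> real ((n + 1) * (n choose (n div 2)))" by (simp only: of_nat_le_iff)
  then show ?thesis by (simp add: algebra_simps)
qed

text \<open>The \<open>2 * n\<close> makes this half the exponent of
  \<open>num_matroids_lower\<close> at the middle rank, which leaves room for summing over all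
  ranks. Within \<open>\<delta> * n\<close> of either end the trivial count is enough; in between,
  both rank and corank are large enough to contract.\<close>

lemma card_minor_free_matroids_eventually:
  "\<forall>\<^sub>F n in sequentially. \<forall>r\<le>n.
     card (minor_free_matroids {1..n} r) \<le> 2 powr (real (n choose (n div 2)) / (2 * n))"
proof -
  obtain \<delta> :: real where \<delta>: "\<delta> > 0" and sparse: "\<And>A :: nat set. finite A \<Longrightarrow>
      card {S. S \<subseteq> A \<and> card S \<le> \<delta> * card A} \<le> 2 powr (1 / 2 * card A)"
    using card_sparse_subsets[of "1 / 2", where ?'a = nat] by auto
  \<comment> \<open>The factor 48 is fitted to the end: division by \<open>(k + 3) choose 3\<close>
    gives at most \<open>24 / (k + 3)\<close>, and \<open>k + 3\<close> exceeds
    \<open>\<delta> * n\<close>, so \<open>\<delta> / 48\<close> leaves at most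
    \<open>1 / (2 * n)\<close>.\<close>
  obtain N where N: "\<And>V :: nat set. finite V \<Longrightarrow> card V \<ge> N \<Longrightarrow>
      card {{X \<in> Ind. card X = 3} | Ind. hexagon_free_matroid V Ind} \<le> 2 powr (\<delta> / 48 * (real (card V))\<^sup>2)"
    using card_hexagon_free_bases[of "\<delta> / 48", where ?'a = nat] \<delta> by auto
  have small: "real (n choose k) \<le> 2 powr (real n / 2)" if "k \<le> \<delta> * n" for n k
  proof -
    have "n choose k = card {S. S \<subseteq> {1..n} \<and> card S = k}" using n_subsets[of "{1..n}" k] by simp
    also have "\<dots> \<le> card {S. S \<subseteq> {1..n} \<and> card S \<le> \<delta> * card {1..n}}"
      by (rule card_mono) (use that in auto)
    finally show ?thesis using sparse[of "{1..n}"] by simp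
  qed
  have "\<forall>\<^sub>F n :: nat in sequentially. 2 powr (real n / 2) \<le> 2 ^ n / ((real n + 1) * (2 * real n))"
    by real_asymp
  moreover have "\<forall>\<^sub>F n :: nat in sequentially. \<delta> * n \<ge> max 3 N"
    using \<delta> by real_asymp
  moreover have "\<forall>\<^sub>F n :: nat in sequentially. n \<ge> 1" by (rule eventually_ge_at_top)
  ultimately show ?thesis
  proof eventually_elim
    case (elim n)
    define L where "L = real (n choose (n div 2))"
    have "2 ^ n / ((real n + 1) * (2 * real n)) \<le> ((real n + 1) * L) / ((real n + 1) * (2 * real n))"
      using central_binomial_ge[of n] unfolding L_def by (intro divide_right_mono) auto
    with elim(1) have "2 powr (real n / 2) \<le> ((real n + 1) * L) / ((real n + 1) * (2 * real n))"
      by (rule order_trans)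
    then have tail: "2 powr (real n / 2) \<le> L / (2 * n)"
      by (subst (asm) mult_divide_mult_cancel_left) auto
    have trivial: "card (minor_free_matroids {1..n} r) \<le> 2 powr (L / (2 * n))"
      if "real (n choose r) \<le> 2 powr (real n / 2)" for r
    proof -
      have "real (card (minor_free_matroids {1..n} r)) \<le> real (2 ^ (n choose r))"
        using card_minor_free_matroids_trivial[of "{1..n}" r] by (simp only: of_nat_le_iff) simp
      also have "\<dots> = 2 powr real (n choose r)" by (simp add: powr_realpow)
      also have "\<dots> \<le> 2 powr (L / (2 * n))" using that tail by simp
      finally show ?thesis .
    qed
    show ?case
    proof (intro allI impI)
      fix r assume r: "r \<le> n"
      consider "r \<le> \<delta> * n" | "real (n - r) \<le> \<delta> * n" | "r > \<delta> * n" "real (n - r) > \<delta> * n" by linarith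
      then show "card (minor_free_matroids {1..n} r) \<le> 2 powr (real (n choose (n div 2)) / (2 * n))"
      proof cases
        case 1
        then show ?thesis using trivial[OF small] by (simp add: L_def)
      next
        case 2
        then show ?thesis using trivial[of r] small[of "n - r" n] binomial_symmetric[OF r] by (simp add: L_def)
      next
        case 3
        define k where "k = n - r"
        have r3: "r \<ge> 3" and k: "k \<ge> 3" "k \<ge> N" "k > \<delta> * n" using 3 elim(2) unfolding k_def by linarith+
        have s: "n - (r - 3) = k + 3" using r r3 by (simp add: k_def)
        have "card (minor_free_matroids {1..n} r)
          \<le> (2 powr (\<delta> / 48 * (real (k + 3))\<^sup>2)) powr (real (card {1..n} choose (r - 3)) / real (r choose (r - 3)))"
        proof (rule card_minor_free_matroids)
          fix V :: "nat set" assume "finite V" "card V = card {1..n} - (r - 3)"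
          then show "card {{X \<in> Ind. card X = 3} | Ind. hexagon_free_matroid V Ind} \<le> 2 powr (\<delta> / 48 * (real (k + 3))\<^sup>2)"
            using N[of V] s k by simp
        qed (use r r3 in auto)
        also have "\<dots> = 2 powr (\<delta> / 48 * (real (k + 3))\<^sup>2 * (real (n choose (r - 3)) / real (r choose (r - 3))))"
          by (simp add: powr_powr)
        also have "real (n choose (r - 3)) / real (r choose (r - 3)) = real (n choose r) / real ((k + 3) choose 3)"
        proof -
          \<comment> \<open>Both sides count pairs of an \<open>r\<close>-set and an
            \<open>(r - 3)\<close>-subset of it, chosen in either order.\<close>
          have "(n choose r) * (r choose (r - 3)) = (n choose (r - 3)) * ((k + 3) choose 3)"
            using choose_mult[of "r - 3" r n] r r3 s by simp
          then have "real (n choose r) * real (r choose (r - 3)) = real (n choose (r - 3)) * real ((k + 3) choose 3)"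
            by (simp flip: of_nat_mult)
          moreover have "real (r choose (r - 3)) > 0" "real ((k + 3) choose 3) > 0" by simp_all
          ultimately show ?thesis by (simp add: field_simps)
        qed
        also have "\<delta> / 48 * (real (k + 3))\<^sup>2 * (real (n choose r) / real ((k + 3) choose 3)) \<le> L / (2 * n)"
        proof -
          have pos: "real ((k + 3) choose 3) > 0" "real n > 0" using elim(3) by simp_all
          have "\<delta> * n * (real (k + 3))\<^sup>2 \<le> real (k + 3) * (real (k + 3))\<^sup>2"
            using k by (intro mult_right_mono) auto
          also have "\<dots> \<le> 24 * real ((k + 3) choose 3)"
            using square_le_choose_three[of k] k by (simp add: mult.commute)
          finally have "\<delta> / 48 * (real (k + 3))\<^sup>2 / real ((k + 3) choose 3) \<le> 1 / (2 * n)"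
            using pos by (simp add: field_simps)
          moreover have "real (n choose r) \<le> L" unfolding L_def using binomial_maximum[of n r] by simp
          ultimately have "\<delta> / 48 * (real (k + 3))\<^sup>2 / real ((k + 3) choose 3) * real (n choose r) \<le> 1 / (2 * n) * L"
            by (intro mult_mono) auto
          then show ?thesis by simp
        qed
        finally show ?thesis by (simp add: L_def)
      qed
    qed
  qed
qed

theorem theorem2:
  shows "(\<lambda>n. real (num_matroids_X n) / real (num_matroids n)) \<longlonglongrightarrow> 0"
proof -
  \<comment> \<open>The factor \<open>n + 1\<close> counts the ranks. The exponent is the gap
    between \<open>L / n\<close> and \<open>L / (2 * n)\<close>, with the central coefficient
    replaced by its lower bound \<open>2 ^ n / (n + 1)\<close>.\<close>
  let ?u = "\<lambda>n :: nat. (real n + 1) * 2 powr (- (2 ^ n / ((real n + 1) * (2 * real n))))"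
  have lim: "?u \<longlonglongrightarrow> 0" by real_asymp
  have "\<forall>\<^sub>F n :: nat in sequentially. n \<ge> 2" by (rule eventually_ge_at_top)
  with card_minor_free_matroids_eventually
  have bound: "\<forall>\<^sub>F n in sequentially. real (num_matroids_X n) / real (num_matroids n) \<le> ?u n"
  proof eventually_elim
    case (elim n)
    define L where "L = real (n choose (n div 2))"
    have "real (num_matroids_X n) \<le> (\<Sum>r\<le>n. real (card (minor_free_matroids {1..n} r)))"
      using num_matroids_X_le[of n] by (simp flip: of_nat_sum)
    also have "\<dots> \<le> (\<Sum>r\<le>n. 2 powr (L / (2 * n)))"
      unfolding L_def by (rule sum_mono) (use elim(1) in auto)
    also have "\<dots> = (real n + 1) * 2 powr (L / (2 * n))" by simp
    finally have up: "real (num_matroids_X n) \<le> (real n + 1) * 2 powr (L / (2 * n))" .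
    have low: "2 powr (L / n) \<le> num_matroids n"
      unfolding L_def by (rule num_matroids_lower) (use elim(2) in auto)
    have "real (num_matroids_X n) / real (num_matroids n) \<le> ((real n + 1) * 2 powr (L / (2 * n))) / 2 powr (L / n)"
      using up low by (intro frac_le) auto
    also have "\<dots> = (real n + 1) * 2 powr (L / (2 * n) - L / n)" by (simp only: powr_diff times_divide_eq_right)
    also have "L / (2 * n) - L / n = - (L / (2 * n))" using elim(2) by (simp add: field_simps)
    also have "(real n + 1) * 2 powr (- (L / (2 * n))) \<le> ?u n"
    proof -
      have "2 ^ n / ((real n + 1) * (2 * real n)) \<le> ((real n + 1) * L) / ((real n + 1) * (2 * real n))"
        using central_binomial_ge[of n] unfolding L_def by (intro divide_right_mono) auto
      also have "\<dots> = L / (2 * n)" using mult_divide_mult_cancel_left[of "real n + 1" L "2 * real n"] by simp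
      finally show ?thesis by simp
    qed
    finally show ?case .
  qed
  show ?thesis by (rule tendsto_sandwich[OF _ bound tendsto_const lim]) auto
qed

end
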